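(* Let $d \geq 1$ be an integer and let $\|\cdot\|_P$ be a polyhedral norm on $\mathbb{R}^d$. For any $s \in [d-1,d]$, there exists a compact set $E \subset \mathbb{R}^d$ with $\dim_H E = s$ such that $$\dim_H \Delta^P(E) = s-(d-1),$$ where $\Delta^P(E) := \{\|x-y\|_P \in [0,\infty) : x,y \in E\}$ is the distance set of $E$ with respect to $\|\cdot\|_P$.
   Context: $\dim_H$ denotes Hausdorff dimension (with respect to the usual Euclidean metric on $\mathbb{R}^d$ and on $\mathbb{R}$). A norm $\|\cdot\|_P$ on $\mathbb{R}^d$ is polyhedral if its closed unit ball is a (convex) polytope; equivalently, there is a finite set of vectors $\{v^1,\dots,v^N\} \subset \mathbb{R}^d$ such that $\|x\|_P = \max_{1 \leq \ell \leq N} |x \cdot v^\ell|$ for all $x \in \mathbb{R}^d$. *)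

theory Defs
  imports "HOL-Analysis.Analysis"
begin

section \<open>Hausdorff measure and dimension\<close>

(* The s-th power of the diameter, with diam({})^s = 0 for every s and
   diam(U)^0 = 1 for nonempty U; the case s = 0 is separate because 0 powr 0 = 0. *)
definition diam_pow :: "real \<Rightarrow> 'a::metric_space set \<Rightarrow> ennreal" where
  "diam_pow s U = (if U = {} then 0 else if s = 0 then 1 else ennreal (diameter U powr s))"

(* Boundedness is required explicitly because the real-valued diameter of an
   unbounded set is unspecified. Finite covers are included by padding with {}. *)
definition delta_covers :: "real \<Rightarrow> 'a::metric_space set \<Rightarrow> (nat \<Rightarrow> 'a set) set" where
  "delta_covers \<delta> A =
     {U. A \<subseteq> (\<Union>i. U i) \<and> (\<forall>i. bounded (U i) \<and> diameter (U i) \<le> \<delta>)}"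

definition hausdorff_premeasure :: "real \<Rightarrow> real \<Rightarrow> 'a::metric_space set \<Rightarrow> ennreal" where
  "hausdorff_premeasure s \<delta> A = (INF U\<in>delta_covers \<delta> A. \<Sum>i. diam_pow s (U i))"

definition hausdorff_measure :: "real \<Rightarrow> 'a::metric_space set \<Rightarrow> ennreal" where
  "hausdorff_measure s A = (SUP \<delta>\<in>{0<..}. hausdorff_premeasure s \<delta> A)"

(* The value is \<infinity> if no exponent qualifies; the empty set has dimension 0. *)
definition hausdorff_dim :: "'a::metric_space set \<Rightarrow> ereal" where
  "hausdorff_dim A = Inf (ereal ` {s. 0 \<le> s \<and> hausdorff_measure s A = 0})"

section \<open>Polyhedral norms and distance sets\<close>

definition is_norm :: "('a::real_vector \<Rightarrow> real) \<Rightarrow> bool" where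
  "is_norm p \<longleftrightarrow>
     (\<forall>x. 0 \<le> p x) \<and>
     (\<forall>x. p x = 0 \<longleftrightarrow> x = 0) \<and>
     (\<forall>c x. p (c *\<^sub>R x) = \<bar>c\<bar> * p x) \<and>
     (\<forall>x y. p (x + y) \<le> p x + p y)"

definition polyhedral_norm :: "('a::real_vector \<Rightarrow> real) \<Rightarrow> bool" where
  "polyhedral_norm p \<longleftrightarrow> is_norm p \<and> polytope {x. p x \<le> 1}"

definition distance_set :: "('a::real_vector \<Rightarrow> real) \<Rightarrow> 'a set \<Rightarrow> real set" where
  "distance_set p E = {p (x - y) | x y. x \<in> E \<and> y \<in> E}"

end

(* The norm is p x = max |v . x| over finitely many v, so it suffices to find a compact E
   of dimension s = d - 1 + \<alpha> such that each set of numbers v . (x - y) with x, y in E has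
   dimension at most \<alpha>. Asking v . x to be close to an arithmetic progression for all v at the
   same scale would make E too small, but a Hausdorff dimension is already bounded by the
   behaviour along one sequence of scales. So E is a nested intersection in which stage j is
   confined to thin slabs, of width \<delta> and distance about \<delta>^\<alpha>, orthogonal to a single v,
   and every v is used at infinitely many stages; each stage costs only the factor \<delta>^(1 - \<alpha>) of
   one slab condition, provided that the scales decrease fast enough. The mass distribution
   principle then gives dim E >= s. The other two bounds follow from dim E <= dim \<Delta> + d - 1,
   which holds because E is contained in the p-spheres about any of its points with radii in \<Delta>. *)

theory Submission
  imports Defs
begin

section \<open>Hausdorff null sets\<close>

text \<open>The two sides of the estimate need different things. A slab stage leaves about
  \<delta>^(-\<alpha>) intervals of length \<delta> for the differences in its direction, and the
  sum \<delta>^(t - \<alpha>) is small for t > \<alpha>; one such \<delta> per tolerance is enough.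
  The mass bound, however, must hold at every radius r. Between two consecutive scales there are two
  regimes: for r above the current gap the new slabs are not resolved and only the previous slab
  condition is felt; for r below it a bounded number of slabs is met, and the gap is at most a
  constant times r^\<alpha>. Powers of earlier scales remain as factors in both regimes; they are
  absorbed in the slack between t and d - 1 + \<alpha>, which forces superexponential decay of the
  scales. An orthogonal change of frame turns every functional into a multiple of the same
  coordinate, so all stages have one shape. The rotated grids of different stages need not be
  compatible, because only nearness and separation of centers pass from one stage to the
  next.\<close>

lemma ennreal_eq_0_if_le_mult_eps:
  fixes x :: ennreal and c :: real
  assumes "0 \<le> c" and le: "\<And>e. 0 < e \<Longrightarrow> x \<le> ennreal (c * e)"
  shows "x = 0"
proof -
  have "x \<le> 0 + ennreal e" if "0 < e" for e
  proof -
    have "x \<le> ennreal (c * (e / (c + 1)))"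
      by (rule le) (use assms(1) that in simp)
    also have "c * (e / (c + 1)) \<le> e"
      using assms(1) that by (simp add: divide_le_eq algebra_simps)
    finally show ?thesis by (simp add: ennreal_leI)
  qed
  then have "x \<le> 0" by (rule ennreal_le_epsilon)
  then show ?thesis by simp
qed

lemma diam_pow_le:
  assumes "0 \<le> s" "bounded U" "diameter U \<le> d" "0 < d"
  shows "diam_pow s U \<le> ennreal (d powr s)"
  using assms unfolding diam_pow_def
  by (auto intro!: ennreal_leI powr_mono2 simp: diameter_ge_0)

text \<open>Sets of a cover may have diameter 0, but the counting arguments divide by a length. A
  positive \<open>h\<close> just above the diameter costs at most \<open>e\<close> because
  \<open>h powr s\<close> is right-continuous; the exponent 0 is separate because
  \<open>0 powr 0 = 0\<close> breaks this at diameter 0.\<close>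

lemma diam_pow_enlarge:
  assumes "bounded U" "U \<noteq> {}" "0 \<le> s" "0 < e" "diameter U < d"
  obtains h where "diameter U < h" "h < d" "ennreal (h powr s) \<le> diam_pow s U + ennreal e"
proof (cases "s = 0")
  case True
  obtain h where h: "diameter U < h" "h < d" using assms(5) dense by blast
  moreover have "0 < h" using h diameter_ge_0[OF assms(1)] by linarith
  ultimately show ?thesis using True assms by (intro that[of h]) (auto simp: diam_pow_def)
next
  case False
  let ?D = "diameter U"
  have D0: "0 \<le> ?D" using diameter_ge_0 assms by blast
  have "((\<lambda>h. h powr s) \<longlongrightarrow> ?D powr s) (at_right ?D)"
    by (rule tendsto_powr')
       (use False assms D0 in \<open>auto simp: eventually_at_filter intro!: tendsto_intros always_eventually\<close>)
  then have "eventually (\<lambda>h. h powr s < ?D powr s + e) (at_right ?D)"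
    by (rule order_tendstoD) (use assms in auto)
  then obtain b where b: "b > ?D" "\<And>h. h > ?D \<Longrightarrow> h < b \<Longrightarrow> h powr s < ?D powr s + e"
    unfolding eventually_at_right_field by blast
  obtain h where h: "?D < h" "h < min b d" using b(1) assms(5) dense[of ?D "min b d"] by auto
  have "ennreal (h powr s) \<le> ennreal (?D powr s + e)"
    using b(2)[of h] h by (intro ennreal_leI) auto
  also have "\<dots> = diam_pow s U + ennreal e"
    using False assms by (auto simp: diam_pow_def ennreal_plus)
  finally show ?thesis using h that by auto
qed

lemma hausdorff_premeasure_le:
  "U \<in> delta_covers d A \<Longrightarrow> hausdorff_premeasure s d A \<le> (\<Sum>i. diam_pow s (U i))"
  unfolding hausdorff_premeasure_def by (rule INF_lower)

lemma hausdorff_premeasure_mono: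
  "A \<subseteq> B \<Longrightarrow> hausdorff_premeasure s d A \<le> hausdorff_premeasure s d B"
  unfolding hausdorff_premeasure_def delta_covers_def by (intro INF_superset_mono) auto

lemma hausdorff_measure_eq_0_iff:
  "hausdorff_measure s A = 0 \<longleftrightarrow> (\<forall>d>0. hausdorff_premeasure s d A = 0)"
  unfolding hausdorff_measure_def unfolding bot_ennreal[symmetric] SUP_bot_conv by auto

lemma hausdorff_measure_eq_0_subset:
  assumes "A \<subseteq> B" "hausdorff_measure s B = 0"
  shows "hausdorff_measure s A = 0"
  unfolding hausdorff_measure_eq_0_iff
proof (intro allI impI)
  fix d :: real assume "0 < d"
  then have "hausdorff_premeasure s d B = 0" using assms(2) by (simp add: hausdorff_measure_eq_0_iff)
  then show "hausdorff_premeasure s d A = 0" using hausdorff_premeasure_mono[OF assms(1), of s d] by simp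
qed

lemma hausdorff_premeasure_cover:
  assumes "hausdorff_premeasure s d A < c"
  obtains U where "U \<in> delta_covers d A" "(\<Sum>i. diam_pow s (U i)) < c"
  using assms unfolding hausdorff_premeasure_def INF_less_iff by blast

lemma hausdorff_premeasure_le_sum:
  assumes "finite F" "A \<subseteq> \<Union>F" "0 \<le> d" and F: "\<And>W. W \<in> F \<Longrightarrow> bounded W \<and> diameter W \<le> d"
  shows "hausdorff_premeasure s d A \<le> (\<Sum>W\<in>F. diam_pow s W)"
proof -
  obtain e where e: "bij_betw e {..<card F} F"
    using assms(1) bij_betw_from_nat_into_finite by blast
  define U where "U i = (if i < card F then e i else {})" for i
  have UF: "U i = {} \<or> U i \<in> F" for i using e by (auto simp: U_def bij_betw_def)
  have UF': "\<Union>F \<subseteq> (\<Union>i. U i)"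
  proof
    fix x assume "x \<in> \<Union>F"
    then obtain W where "W \<in> F" "x \<in> W" by auto
    moreover from this e obtain i where "i < card F" "e i = W"
      by (metis bij_betw_iff_bijections lessThan_iff)
    ultimately show "x \<in> (\<Union>i. U i)" by (auto simp: U_def)
  qed
  have "U \<in> delta_covers d A"
    unfolding delta_covers_def mem_Collect_eq
  proof (intro conjI allI)
    show "A \<subseteq> (\<Union>i. U i)" using assms(2) UF' by (rule order_trans)
    show "bounded (U i)" "diameter (U i) \<le> d" for i
      using UF[of i] F[of "U i"] assms(3) by auto
  qed
  then have "hausdorff_premeasure s d A \<le> (\<Sum>i. diam_pow s (U i))" by (rule hausdorff_premeasure_le)
  also have "\<dots> = (\<Sum>i<card F. diam_pow s (U i))"
    by (intro suminf_finite) (auto simp: U_def diam_pow_def)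
  also have "\<dots> = (\<Sum>i<card F. diam_pow s (e i))" by (intro sum.cong) (auto simp: U_def)
  also have "\<dots> = (\<Sum>W\<in>F. diam_pow s W)" using e by (rule sum.reindex_bij_betw)
  finally show ?thesis .
qed

lemma hausdorff_premeasure_le_card:
  assumes "finite F" "A \<subseteq> \<Union>F" "0 \<le> s" "0 < h" "h \<le> d"
    and F: "\<And>W. W \<in> F \<Longrightarrow> bounded W \<and> diameter W \<le> h"
  shows "hausdorff_premeasure s d A \<le> ennreal (real (card F) * h powr s)"
proof -
  have "hausdorff_premeasure s d A \<le> (\<Sum>W\<in>F. diam_pow s W)"
    using assms by (intro hausdorff_premeasure_le_sum) force+
  also have "\<dots> \<le> (\<Sum>W\<in>F. ennreal (h powr s))"
    using assms by (intro sum_mono diam_pow_le) auto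
  also have "\<dots> = ennreal (real (card F) * h powr s)"
    by (simp add: ennreal_mult ennreal_of_nat_eq_real_of_nat)
  finally show ?thesis .
qed

lemma suminf_ennreal_half: "0 \<le> e \<Longrightarrow> (\<Sum>n. ennreal (e * (1/2) ^ Suc n)) = ennreal e"
  using power_half_series sums_mult[OF power_half_series, of e]
  by (intro suminf_ennreal_eq) auto

lemma hausdorff_premeasure_UN_le:
  "hausdorff_premeasure s d (\<Union>i. A i) \<le> (\<Sum>i::nat. hausdorff_premeasure s d (A i))"
proof (rule ennreal_le_epsilon)
  fix e :: real
  assume e: "0 < e" and fin: "(\<Sum>i. hausdorff_premeasure s d (A i)) < top"
  have *: "\<exists>U\<in>delta_covers d (A i).
      (\<Sum>k. diam_pow s (U k)) \<le> hausdorff_premeasure s d (A i) + ennreal (e * (1/2) ^ Suc i)" for i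
  proof -
    \<comment> \<open>Finiteness makes adding a positive number a strict increase, as the choice of
      a cover requires.\<close>
    have "hausdorff_premeasure s d (A i) < top"
      by (rule ennreal_suminf_lessD[OF fin])
    then have "hausdorff_premeasure s d (A i)
        < hausdorff_premeasure s d (A i) + ennreal (e * (1/2) ^ Suc i)"
      using e ennreal_add_left_cancel_less[of "hausdorff_premeasure s d (A i)" 0 "ennreal (e * (1/2) ^ Suc i)"]
      by auto
    then obtain U where "U \<in> delta_covers d (A i)"
      "(\<Sum>k. diam_pow s (U k)) < hausdorff_premeasure s d (A i) + ennreal (e * (1/2) ^ Suc i)"
      by (rule hausdorff_premeasure_cover)
    then show ?thesis by (intro bexI[of _ U] less_imp_le)
  qed
  have "\<exists>U. \<forall>i. U i \<in> delta_covers d (A i) \<and>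
      (\<Sum>k. diam_pow s (U i k)) \<le> hausdorff_premeasure s d (A i) + ennreal (e * (1/2) ^ Suc i)"
    by (rule choice) (use * in blast)
  then obtain U where U: "\<And>i. U i \<in> delta_covers d (A i)"
    "\<And>i. (\<Sum>k. diam_pow s (U i k)) \<le> hausdorff_premeasure s d (A i) + ennreal (e * (1/2) ^ Suc i)"
    by auto
  define W where "W n = U (fst (prod_decode n)) (snd (prod_decode n))" for n
  have "(\<Union>i. A i) \<subseteq> (\<Union>n. W n)"
  proof (rule UN_least, rule subsetI)
    fix i x assume "x \<in> A i"
    moreover have "A i \<subseteq> (\<Union>k. U i k)" using U(1)[of i] unfolding delta_covers_def by simp
    ultimately obtain k where "x \<in> U i k" by blast
    then have "x \<in> W (prod_encode (i, k))" by (simp add: W_def)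
    then show "x \<in> (\<Union>n. W n)" by (rule UN_I[OF UNIV_I])
  qed
  moreover have "bounded (W n) \<and> diameter (W n) \<le> d" for n
    using U(1)[of "fst (prod_decode n)"] unfolding W_def delta_covers_def by simp
  ultimately have "W \<in> delta_covers d (\<Union>i. A i)"
    unfolding delta_covers_def by simp
  then have "hausdorff_premeasure s d (\<Union>i. A i) \<le> (\<Sum>n. diam_pow s (W n))"
    by (rule hausdorff_premeasure_le)
  also have "\<dots> = (\<Sum>i. \<Sum>k. diam_pow s (U i k))"
    unfolding W_def
    by (rule suminf_ennreal_2dimen[where f = "\<lambda>z. diam_pow s (U (fst z) (snd z))"]) simp
  also have "\<dots> \<le> (\<Sum>i. hausdorff_premeasure s d (A i) + ennreal (e * (1/2) ^ Suc i))"
    by (rule suminf_le[OF U(2)]) (rule summableI)+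
  also have "\<dots> = (\<Sum>i. hausdorff_premeasure s d (A i)) + ennreal e"
    by (subst suminf_add[OF summableI summableI, symmetric])
      (simp only: suminf_ennreal_half[OF less_imp_le[OF e]])
  finally show "hausdorff_premeasure s d (\<Union>i. A i)
      \<le> (\<Sum>i. hausdorff_premeasure s d (A i)) + ennreal e" .
qed

lemma hausdorff_premeasure_empty: "0 \<le> d \<Longrightarrow> hausdorff_premeasure s d {} = 0"
  using hausdorff_premeasure_le_sum[of "{}" "{}" d s] by simp

lemma hausdorff_premeasure_Un_le:
  assumes "0 \<le> d"
  shows "hausdorff_premeasure s d (A \<union> B) \<le> hausdorff_premeasure s d A + hausdorff_premeasure s d B"
proof -
  define C where "C i = (if i = 0 then A else if i = 1 then B else {})" for i :: nat
  have "C 0 \<union> C 1 \<subseteq> (\<Union>i. C i)" by blast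
  then have "hausdorff_premeasure s d (A \<union> B) \<le> hausdorff_premeasure s d (\<Union>i. C i)"
    by (intro hausdorff_premeasure_mono) (simp add: C_def)
  also have "\<dots> \<le> (\<Sum>i. hausdorff_premeasure s d (C i))" by (rule hausdorff_premeasure_UN_le)
  also have "\<dots> = (\<Sum>i\<in>{0,1}. hausdorff_premeasure s d (C i))"
    by (intro suminf_finite) (auto simp: C_def hausdorff_premeasure_empty assms)
  finally show ?thesis by (simp add: C_def)
qed

lemma hausdorff_measure_eq_0_UN:
  assumes "finite I" "\<And>i. i \<in> I \<Longrightarrow> hausdorff_measure s (A i) = 0"
  shows "hausdorff_measure s (\<Union>i\<in>I. A i) = 0"
  using assms
proof (induction I)
  case empty
  then show ?case by (simp add: hausdorff_measure_eq_0_iff hausdorff_premeasure_empty)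
next
  case (insert j I)
  have "hausdorff_premeasure s d (A j \<union> (\<Union>i\<in>I. A i)) \<le> 0" if "0 < d" for d
    using hausdorff_premeasure_Un_le[of d s "A j" "\<Union>i\<in>I. A i"] insert that
    by (simp add: hausdorff_measure_eq_0_iff)
  then show ?case by (simp add: hausdorff_measure_eq_0_iff)
qed

lemma hausdorff_dim_eqI:
  assumes "0 \<le> a"
    and null: "\<And>t. a < t \<Longrightarrow> hausdorff_measure t A = 0"
    and pos: "\<And>t. 0 \<le> t \<Longrightarrow> t < a \<Longrightarrow> hausdorff_measure t A \<noteq> 0"
  shows "hausdorff_dim A = ereal a"
  unfolding hausdorff_dim_def
proof (rule antisym)
  show "Inf (ereal ` {s. 0 \<le> s \<and> hausdorff_measure s A = 0}) \<le> ereal a"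
  proof (rule ereal_le_epsilon2)
    fix e :: real assume "0 < e"
    then show "Inf (ereal ` {s. 0 \<le> s \<and> hausdorff_measure s A = 0}) \<le> ereal a + ereal e"
      using assms by (intro Inf_lower) auto
  qed
  show "ereal a \<le> Inf (ereal ` {s. 0 \<le> s \<and> hausdorff_measure s A = 0})"
    using pos by (intro Inf_greatest) force
qed

text \<open>Each set of a cover of the image, enlarged to length \<open>h\<close>, is replaced by at
  most \<open>C / h ^ m\<close> sets of diameter at most \<open>K * h\<close>. At exponent
  \<open>t + m\<close> these contribute at most a constant times \<open>h powr t\<close>, so the
  cover sum of the image controls that of \<open>E\<close>.\<close>

lemma hausdorff_measure_eq_0_fibres:
  fixes f :: "'a::metric_space \<Rightarrow> 'b::metric_space"
  assumes null: "hausdorff_measure t (f ` E) = 0" and "0 \<le> t" "0 \<le> C" "0 < K"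
    and fibre: "\<And>V h. 0 < h \<Longrightarrow> h \<le> 1 \<Longrightarrow> bounded V \<Longrightarrow> diameter V \<le> h \<Longrightarrow>
      \<exists>F. finite F \<and> real (card F) * h ^ m \<le> C \<and>
          (\<forall>W\<in>F. bounded W \<and> diameter W \<le> K * h) \<and> {x \<in> E. f x \<in> V} \<subseteq> \<Union>F"
  shows "hausdorff_measure (t + real m) E = 0"
  unfolding hausdorff_measure_eq_0_iff
proof (intro allI impI)
  fix d :: real assume d: "0 < d"
  define B where "B = C * K powr (t + real m)"
  have B0: "0 \<le> B" using assms by (simp add: B_def)
  show "hausdorff_premeasure (t + real m) d E = 0"
  proof (rule ennreal_eq_0_if_le_mult_eps[of "2 * B"])
    fix e :: real assume e: "0 < e"
    \<comment> \<open>\<open>h\<close> has to satisfy both \<open>h \<le> 1\<close> and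
      \<open>K * h \<le> d\<close>. Covering at \<open>\<rho> / 2\<close> leaves room for
      \<open>h\<close> strictly between the diameter and \<open>\<rho>\<close>.\<close>
    define \<rho> where "\<rho> = min 1 (d / K)"
    have \<rho>: "0 < \<rho>" using d assms by (simp add: \<rho>_def)
    have "hausdorff_premeasure t (\<rho> / 2) (f ` E) < ennreal e"
      using null \<rho> e by (simp add: hausdorff_measure_eq_0_iff)
    then obtain V where V: "V \<in> delta_covers (\<rho> / 2) (f ` E)" "(\<Sum>i. diam_pow t (V i)) < ennreal e"
      by (rule hausdorff_premeasure_cover)
    define A where "A i = {x \<in> E. f x \<in> V i}" for i
    have A: "hausdorff_premeasure (t + real m) d (A i)
        \<le> ennreal B * (diam_pow t (V i) + ennreal (e * (1/2) ^ Suc i))" for i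
    proof (cases "V i = {}")
      case True
      then show ?thesis using d by (simp add: A_def hausdorff_premeasure_empty)
    next
      case False
      have bV: "bounded (V i)" "diameter (V i) < \<rho>"
        using V(1) \<rho> le_less_trans[of "diameter (V i)" "\<rho> / 2" \<rho>]
        by (auto simp: delta_covers_def)
      have e': "0 < e * (1/2) ^ Suc i" using e by simp
      obtain h where h: "diameter (V i) < h" "h < \<rho>"
        "ennreal (h powr t) \<le> diam_pow t (V i) + ennreal (e * (1/2) ^ Suc i)"
        by (rule diam_pow_enlarge[OF bV(1) False assms(2) e' bV(2)])
      have h0: "0 < h" using h(1) diameter_ge_0[OF bV(1)] by linarith
      have "h \<le> 1" "K * h \<le> d" using h(2) assms(4) by (auto simp: \<rho>_def field_simps)
      then obtain F where F: "finite F" "real (card F) * h ^ m \<le> C"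
        "\<forall>W\<in>F. bounded W \<and> diameter W \<le> K * h" "A i \<subseteq> \<Union>F"
        using fibre[OF h0 _ bV(1) less_imp_le[OF h(1)]] unfolding A_def by blast
      have "hausdorff_premeasure (t + real m) d (A i)
          \<le> ennreal (real (card F) * (K * h) powr (t + real m))"
        using F h0 assms \<open>K * h \<le> d\<close> by (intro hausdorff_premeasure_le_card) auto
      also have "real (card F) * (K * h) powr (t + real m)
          = (real (card F) * h ^ m) * K powr (t + real m) * h powr t"
        using h0 assms by (simp add: powr_mult powr_add powr_realpow)
      also have "ennreal \<dots> \<le> ennreal (B * h powr t)"
        unfolding B_def using F(2) by (intro ennreal_leI mult_right_mono) auto
      also have "\<dots> = ennreal B * ennreal (h powr t)" using B0 by (simp add: ennreal_mult)
      also have "\<dots> \<le> ennreal B * (diam_pow t (V i) + ennreal (e * (1/2) ^ Suc i))"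
        using h(3) by (intro mult_left_mono) auto
      finally show ?thesis .
    qed
    have "E \<subseteq> (\<Union>i. A i)" using V(1) by (auto simp: A_def delta_covers_def)
    then have "hausdorff_premeasure (t + real m) d E \<le> hausdorff_premeasure (t + real m) d (\<Union>i. A i)"
      by (rule hausdorff_premeasure_mono)
    also have "\<dots> \<le> (\<Sum>i. hausdorff_premeasure (t + real m) d (A i))"
      by (rule hausdorff_premeasure_UN_le)
    also have "\<dots> \<le> (\<Sum>i. ennreal B * (diam_pow t (V i) + ennreal (e * (1/2) ^ Suc i)))"
      by (rule suminf_le[OF A]) (rule summableI)+
    also have "\<dots> = ennreal B * (\<Sum>i. diam_pow t (V i) + ennreal (e * (1/2) ^ Suc i))"
      by (rule ennreal_suminf_cmult)
    also have "(\<Sum>i. diam_pow t (V i) + ennreal (e * (1/2) ^ Suc i))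
        = (\<Sum>i. diam_pow t (V i)) + (\<Sum>i. ennreal (e * (1/2) ^ Suc i))"
      by (rule suminf_add[OF summableI summableI, symmetric])
    also have "(\<Sum>i. ennreal (e * (1/2) ^ Suc i)) = ennreal e"
      using e by (intro suminf_ennreal_half) simp
    also have "ennreal B * ((\<Sum>i. diam_pow t (V i)) + ennreal e) \<le> ennreal B * (ennreal e + ennreal e)"
      using V(2) by (intro mult_left_mono add_right_mono) auto
    also have "\<dots> = ennreal (2 * B * e)"
    proof -
      have "ennreal (2 * B * e) = ennreal (B * (e + e))" by (simp add: algebra_simps)
      also have "\<dots> = ennreal B * ennreal (e + e)" using e B0 by (intro ennreal_mult) auto
      also have "ennreal (e + e) = ennreal e + ennreal e" using e by (intro ennreal_plus) auto
      finally show ?thesis by simp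
    qed
    finally show "hausdorff_premeasure (t + real m) d E \<le> ennreal (2 * B * e)" .
  qed (use B0 in auto)
qed

section \<open>Polyhedral norms and strips\<close>

text \<open>The half-spaces cutting out the unit ball, normalised to
  \<open>v \<bullet> x \<le> 1\<close>, supply the functionals. Attainment is the form wanted later:
  both uses sort pairs of points by the \<open>v\<close> that computes their distance.\<close>

lemma polyhedral_norm_functionals:
  fixes p :: "'a::euclidean_space \<Rightarrow> real"
  assumes "polyhedral_norm p"
  obtains V where "finite V" "0 \<notin> V" "\<And>x. \<exists>v\<in>V. p x = \<bar>v \<bullet> x\<bar>"
proof -
  have nonneg: "0 \<le> p x" and zero: "p x = 0 \<longleftrightarrow> x = 0"
    and scale: "p (c *\<^sub>R x) = \<bar>c\<bar> * p x" for x c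
    using assms unfolding polyhedral_norm_def is_norm_def by auto
  have "polyhedron {x. p x \<le> 1}"
    using assms unfolding polyhedral_norm_def by (simp add: polytope_imp_polyhedron)
  then obtain F where F: "finite F" "{x. p x \<le> 1} = \<Inter>F"
    "\<forall>h\<in>F. \<exists>a b. a \<noteq> 0 \<and> h = {x. a \<bullet> x \<le> b}"
    unfolding polyhedron_def by blast
  have "\<exists>v. v \<noteq> 0 \<and> h = {x. v \<bullet> x \<le> 1}" if "h \<in> F" for h
  proof -
    obtain a b where ab: "a \<noteq> 0" "h = {x. a \<bullet> x \<le> b}" using F(3) \<open>h \<in> F\<close> by blast
    \<comment> \<open>The ball contains a positive multiple of the normal \<open>a\<close>, so the
      half-space has positive offset and can be rescaled to offset 1.\<close>
    have pa: "0 < p a" using nonneg[of a] zero[of a] ab by linarith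
    have "p ((1 / p a) *\<^sub>R a) \<le> 1" using pa by (simp add: scale)
    then have "(1 / p a) *\<^sub>R a \<in> h" using F(2) \<open>h \<in> F\<close> by blast
    then have "(1 / p a) * (a \<bullet> a) \<le> b" using ab by simp
    moreover have "0 < (1 / p a) * (a \<bullet> a)" using pa ab by simp
    ultimately have "0 < b" by linarith
    then show ?thesis using ab by (intro exI[of _ "(1 / b) *\<^sub>R a"]) (auto simp: field_simps)
  qed
  then obtain w where w: "\<And>h. h \<in> F \<Longrightarrow> w h \<noteq> 0 \<and> h = {x. w h \<bullet> x \<le> 1}" by metis
  define V where "V = w ` F"
  have ball: "p x \<le> 1 \<longleftrightarrow> (\<forall>v\<in>V. v \<bullet> x \<le> 1)" for x
  proof -
    have "p x \<le> 1 \<longleftrightarrow> x \<in> \<Inter>F" using F(2) by blast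
    also have "\<dots> \<longleftrightarrow> (\<forall>h\<in>F. w h \<bullet> x \<le> 1)" using w by blast
    finally show ?thesis by (simp add: V_def)
  qed
  have ball': "p x \<le> r \<longleftrightarrow> (\<forall>v\<in>V. v \<bullet> x \<le> r)" if "0 < r" for x r
    using ball[of "(1 / r) *\<^sub>R x"] that by (simp add: scale)
  have "V \<noteq> {}"
  proof
    assume "V = {}"
    obtain i :: 'a where i: "i \<in> Basis" using nonempty_Basis by blast
    then have pi: "0 < p i" using nonneg[of i] zero[of i] nonzero_Basis by force
    have "p ((2 / p i) *\<^sub>R i) \<le> 1" using ball \<open>V = {}\<close> by blast
    then show False using pi by (simp add: scale)
  qed
  have "\<exists>v\<in>V. p x = \<bar>v \<bullet> x\<bar>" for x
  proof (cases "x = 0")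
    case True
    then show ?thesis using \<open>V \<noteq> {}\<close> zero[of x] by auto
  next
    case False
    then have px: "0 < p x" using nonneg[of x] zero[of x] by linarith
    have le: "v \<bullet> x \<le> p x" if "v \<in> V" for v using ball'[OF px, of x] that by blast
    have "\<exists>v\<in>V. v \<bullet> x = p x"
    proof (rule ccontr)
      assume "\<not> ?thesis"
      then have lt: "v \<bullet> x < p x" if "v \<in> V" for v using le that by force
      \<comment> \<open>If no functional attained \<open>p x\<close>, the finitely many values would
        stay below some \<open>M < p x\<close>, placing \<open>x\<close> in the ball of radius
        \<open>M\<close>. Including \<open>p x / 2\<close> keeps \<open>M\<close> positive, so that
        the ball can be rescaled.\<close>
      define M where "M = Max (insert (p x / 2) ((\<lambda>v. v \<bullet> x) ` V))"
      have fin: "finite (insert (p x / 2) ((\<lambda>v. v \<bullet> x) ` V))" using F(1) by (simp add: V_def)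
      have "M < p x" unfolding M_def using fin lt px by (subst Max_less_iff) auto
      moreover have "p x / 2 \<le> M" unfolding M_def by (rule Max_ge[OF fin]) simp
      moreover have "v \<bullet> x \<le> M" if "v \<in> V" for v
        unfolding M_def by (rule Max_ge[OF fin]) (use that in simp)
      ultimately show False using ball'[of M x] px by fastforce
    qed
    then show ?thesis using px by force
  qed
  moreover have "finite V" "0 \<notin> V" using F(1) w by (auto simp: V_def)
  ultimately show ?thesis using that by blast
qed

lemma orthogonal_coordinate:
  fixes v :: "real ^ 'n" and k :: 'n
  obtains f :: "real ^ 'n \<Rightarrow> real ^ 'n"
    where "orthogonal_transformation f" "\<And>x. v \<bullet> x = norm v * f x $ k"
proof -
  obtain f :: "real ^ 'n \<Rightarrow> real ^ 'n"
    where f: "orthogonal_transformation f" "f v = axis k (norm v)"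
    using orthogonal_transformation_exists[of v "axis k (norm v)"] norm_eq_sqrt_inner[of "axis k (norm v)"]
    by (auto simp: inner_axis_axis)
  have "v \<bullet> x = norm v * f x $ k" for x
  proof -
    have "v \<bullet> x = f v \<bullet> f x" using f(1) by (simp add: orthogonal_transformation_def)
    also have "\<dots> = norm v * f x $ k" by (simp add: f(2) inner_axis')
    finally show ?thesis .
  qed
  then show ?thesis using f(1) that by blast
qed

lemma diameter_le_dist:
  fixes U :: "'a::metric_space set"
  assumes "0 \<le> d" "\<And>x y. x \<in> U \<Longrightarrow> y \<in> U \<Longrightarrow> dist x y \<le> d"
  shows "bounded U \<and> diameter U \<le> d"
proof -
  have "bounded U" using assms(2) unfolding bounded_two_points by blast
  moreover have "diameter U \<le> d"
    using assms by (auto simp: diameter_def intro!: cSUP_least)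
  ultimately show ?thesis ..
qed

text \<open>Membership in \<open>V\<close> confines coordinate \<open>k\<close> to two pieces of
  length at most \<open>h / c\<close>, one per sign, so its cell records only the sign. The other
  coordinates are cut into intervals of length \<open>h\<close>, which costs about
  \<open>(R / h) ^ (CARD('n) - 1)\<close> cells.\<close>

lemma orthogonal_strip_cover:
  fixes f :: "real ^ 'n \<Rightarrow> real ^ 'n" and k :: 'n
  assumes f: "orthogonal_transformation f" and h: "0 < h" "h \<le> R" and c: "0 < c"
    and V: "bounded V" "diameter V \<le> h"
    and A: "A \<subseteq> cball y R" "\<And>x. x \<in> A \<Longrightarrow> c * \<bar>f (x - y) $ k\<bar> \<in> V"
  shows "\<exists>F. finite F \<and> real (card F) * h ^ (CARD('n) - 1) \<le> 2 * (4 * R) ^ (CARD('n) - 1) \<and>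
    (\<forall>W\<in>F. bounded W \<and> diameter W \<le> real CARD('n) * (1 + 1 / c) * h) \<and> A \<subseteq> \<Union>F"
proof -
  define z where "z x = f (x - y)" for x
  define cell where "cell x = (\<lambda>i. if i = k then (if 0 \<le> z x $ k then 0 else 1) else \<lfloor>z x $ i / h\<rfloor>)" for x
  define N where "N = \<lfloor>R / h\<rfloor>"
  define S where "S i = (if i = k then {0, 1::int} else {- N - 1..N})" for i :: 'n
  have N: "0 \<le> N" using h by (simp add: N_def)
  have z: "\<bar>z x $ i\<bar> \<le> R" if "x \<in> A" for x i
  proof -
    have "\<bar>z x $ i\<bar> \<le> norm (x - y)"
      using component_le_norm_cart[of "z x" i] f unfolding z_def
      by (simp add: orthogonal_transformation_norm)
    also have "\<dots> \<le> R" using A(1) that by (auto simp: dist_norm norm_minus_commute)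
    finally show ?thesis .
  qed
  have cell: "cell x \<in> PiE UNIV S" if "x \<in> A" for x
  proof -
    have "\<lfloor>z x $ i / h\<rfloor> \<in> {- N - 1..N}" for i
    proof -
      have "z x $ i / h \<le> R / h" "- (R / h) \<le> z x $ i / h"
        using z[OF that, of i] h by (auto simp: field_simps abs_le_iff)
      then have "\<lfloor>z x $ i / h\<rfloor> \<le> N" "\<lfloor>- (R / h)\<rfloor> \<le> \<lfloor>z x $ i / h\<rfloor>"
        unfolding N_def by (intro floor_mono; simp)+
      moreover have "- N - 1 \<le> \<lfloor>- (R / h)\<rfloor>" unfolding N_def by linarith
      ultimately show ?thesis by auto
    qed
    then show ?thesis by (auto simp: cell_def S_def PiE_def)
  qed
  define F where "F = (\<lambda>n. {x \<in> A. cell x = n}) ` PiE UNIV S"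
  have fin: "finite (PiE UNIV S)" by (rule finite_PiE) (auto simp: S_def)
  have "card F \<le> card (PiE UNIV S)" unfolding F_def by (rule card_image_le[OF fin])
  also have "\<dots> = (\<Prod>i\<in>UNIV. card (S i))" by (simp add: card_PiE)
  also have "\<dots> = card (S k) * (\<Prod>i\<in>UNIV - {k}. card (S i))" by (subst prod.remove[of _ k]) auto
  also have "(\<Prod>i\<in>UNIV - {k}. card (S i)) = (\<Prod>i\<in>UNIV - {k}. nat (2 * N + 2))"
    by (intro prod.cong) (auto simp: S_def)
  also have "card (S k) = 2" by (simp add: S_def)
  finally have card: "card F \<le> 2 * nat (2 * N + 2) ^ (CARD('n) - 1)" by simp
  \<comment> \<open>\<open>h \<le> R\<close> absorbs the two extra cells, which come from index 0
    and from rounding down at the negative end.\<close>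
  have "real (nat (2 * N + 2)) * h \<le> 4 * R"
  proof -
    have "real_of_int N \<le> R / h" unfolding N_def by simp
    then have "real_of_int N * h \<le> R" using h by (simp add: field_simps)
    then show ?thesis using N h by (simp add: algebra_simps)
  qed
  then have "2 * (real (nat (2 * N + 2)) * h) ^ (CARD('n) - 1) \<le> 2 * (4 * R) ^ (CARD('n) - 1)"
    using h by (intro mult_left_mono power_mono) auto
  moreover have "real (card F) * h ^ (CARD('n) - 1)
      \<le> real (2 * nat (2 * N + 2) ^ (CARD('n) - 1)) * h ^ (CARD('n) - 1)"
    using card h by (intro mult_right_mono) (simp_all only: of_nat_le_iff zero_le_power less_imp_le)
  ultimately have card': "real (card F) * h ^ (CARD('n) - 1) \<le> 2 * (4 * R) ^ (CARD('n) - 1)"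
    by (simp add: power_mult_distrib)
  have "bounded W \<and> diameter W \<le> real CARD('n) * (1 + 1 / c) * h" if "W \<in> F" for W
  proof (rule diameter_le_dist)
    show "0 \<le> real CARD('n) * (1 + 1 / c) * h" using h c by simp
    fix x x' assume "x \<in> W" "x' \<in> W"
    then have x: "x \<in> A" "x' \<in> A" "cell x = cell x'" using that by (auto simp: F_def)
    have comp: "\<bar>(z x - z x') $ i\<bar> \<le> (1 + 1 / c) * h" for i
    proof (cases "i = k")
      case True
      have "(0 \<le> z x $ k) = (0 \<le> z x' $ k)"
        using fun_cong[OF x(3), of k] by (auto simp: cell_def split: if_splits)
      then have "c * \<bar>(z x - z x') $ k\<bar> = \<bar>c * \<bar>z x $ k\<bar> - c * \<bar>z x' $ k\<bar>\<bar>"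
        using c by (auto simp: abs_if algebra_simps)
      also have "\<dots> = dist (c * \<bar>z x $ k\<bar>) (c * \<bar>z x' $ k\<bar>)" by (simp add: dist_real_def)
      also have "\<dots> \<le> diameter V"
        using A(2)[OF x(1)] A(2)[OF x(2)] unfolding z_def
        by (rule diameter_bounded_bound[OF V(1)])
      also have "\<dots> \<le> h" by (rule V)
      finally have "\<bar>(z x - z x') $ k\<bar> \<le> (1 / c) * h" using c by (simp add: field_simps)
      also have "\<dots> \<le> (1 + 1 / c) * h" using h by (simp add: algebra_simps)
      finally show ?thesis using True by simp
    next
      case False
      have "\<lfloor>z x $ i / h\<rfloor> = \<lfloor>z x' $ i / h\<rfloor>" using fun_cong[OF x(3), of i] False by (simp add: cell_def)
      then have "\<bar>z x $ i / h - z x' $ i / h\<bar> \<le> 1" by linarith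
      then have "\<bar>(z x - z x') $ i\<bar> \<le> h" using h by (simp add: field_simps flip: diff_divide_distrib)
      also have "\<dots> \<le> (1 + 1 / c) * h" using h c by (simp add: algebra_simps)
      finally show ?thesis .
    qed
    have "dist x x' = norm (z x - z x')"
      using f unfolding z_def
      by (simp add: dist_norm orthogonal_transformation_norm
          flip: linear_diff[OF orthogonal_transformation_linear[OF f]])
    also have "\<dots> \<le> (\<Sum>i\<in>UNIV. \<bar>(z x - z x') $ i\<bar>)" by (rule norm_le_l1_cart)
    also have "\<dots> \<le> (\<Sum>i\<in>(UNIV::'n set). (1 + 1 / c) * h)" by (intro sum_mono comp)
    finally show "dist x x' \<le> real CARD('n) * (1 + 1 / c) * h" by (simp add: mult.assoc)
  qed
  moreover have "A \<subseteq> \<Union>F" using cell by (auto simp: F_def)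
  moreover have "finite F" using fin by (simp add: F_def)
  ultimately show ?thesis using card' by blast
qed

text \<open>With \<open>y\<close> in \<open>E\<close> fixed, \<open>E\<close> splits into finitely
  many pieces according to the \<open>v\<close> that computes \<open>p (x - y)\<close>. On each
  piece this function takes values in the distance set, and its fibres lie in strips orthogonal to
  \<open>v\<close>, hence have codimension one.\<close>

lemma hausdorff_measure_eq_0_if_distance_set:
  fixes p :: "real ^ 'n \<Rightarrow> real" and E :: "(real ^ 'n) set"
  assumes V: "finite V" "0 \<notin> V" "\<And>x. \<exists>v\<in>V. p x = \<bar>v \<bullet> x\<bar>"
    and E: "bounded E" "E \<noteq> {}" and t: "0 \<le> t"
    and null: "hausdorff_measure t (distance_set p E) = 0"
  shows "hausdorff_measure (t + (real CARD('n) - 1)) E = 0"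
proof -
  obtain y where y: "y \<in> E" using E by blast
  obtain R0 where R0: "\<And>x. x \<in> E \<Longrightarrow> dist y x \<le> R0"
    using E(1) unfolding bounded_any_center[of _ y] by blast
  \<comment> \<open>The strip cover is applied for every \<open>h \<le> 1\<close> and asks for
    \<open>h \<le> R\<close>.\<close>
  define R where "R = max 1 R0"
  have R: "1 \<le> R" "\<And>x. x \<in> E \<Longrightarrow> dist y x \<le> R"
    using R0 max.coboundedI2[of _ R0 1] by (simp_all add: R_def)
  define A where "A v = {x \<in> E. p (x - y) = \<bar>v \<bullet> (x - y)\<bar>}" for v
  have "hausdorff_measure (t + real (CARD('n) - 1)) (A v) = 0" if "v \<in> V" for v
  proof -
    obtain k :: 'n where True by simp
    obtain f :: "real ^ 'n \<Rightarrow> real ^ 'n"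
      where f: "orthogonal_transformation f" "\<And>x. v \<bullet> x = norm v * f x $ k"
      using orthogonal_coordinate[of v k] by blast
    have v: "0 < norm v" using V(2) that by auto
    show ?thesis
    proof (rule hausdorff_measure_eq_0_fibres[where f = "\<lambda>x. p (x - y)"])
      have "(\<lambda>x. p (x - y)) ` A v \<subseteq> distance_set p E"
        using y unfolding A_def distance_set_def by blast
      then show "hausdorff_measure t ((\<lambda>x. p (x - y)) ` A v) = 0"
        using null by (rule hausdorff_measure_eq_0_subset)
      show "0 \<le> 2 * (4 * R) ^ (CARD('n) - 1)" by (simp add: R_def)
      show "0 < real CARD('n) * (1 + 1 / norm v)" using v by (simp add: add_pos_pos)
      fix W :: "real set" and h :: real
      assume h: "0 < h" "h \<le> 1" and W: "bounded W" "diameter W \<le> h"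
      show "\<exists>F. finite F \<and> real (card F) * h ^ (CARD('n) - 1) \<le> 2 * (4 * R) ^ (CARD('n) - 1) \<and>
        (\<forall>U\<in>F. bounded U \<and> diameter U \<le> real CARD('n) * (1 + 1 / norm v) * h) \<and>
        {x \<in> A v. p (x - y) \<in> W} \<subseteq> \<Union>F"
        by (rule orthogonal_strip_cover[OF f(1) h(1) _ v W, where y = y and k = k])
          (use h R in \<open>auto simp: A_def f(2) abs_mult\<close>)
    qed (rule t)
  qed
  then have "hausdorff_measure (t + real (CARD('n) - 1)) (\<Union>v\<in>V. A v) = 0"
    by (rule hausdorff_measure_eq_0_UN[OF V(1)])
  moreover have "(\<Union>v\<in>V. A v) = E" using V(3) by (auto simp: A_def)
  moreover have "real (CARD('n) - 1) = real CARD('n) - 1" by (simp add: of_nat_diff)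
  ultimately show ?thesis by simp
qed

section \<open>The slab construction\<close>

lemma card_nat_spread_le:
  fixes A :: "nat set"
  assumes "A \<noteq> {}" and B: "\<And>x y. x \<in> A \<Longrightarrow> y \<in> A \<Longrightarrow> \<bar>real x - real y\<bar> \<le> B"
  shows "finite A \<and> real (card A) \<le> B + 1"
proof -
  define a where "a = (LEAST x. x \<in> A)"
  have a: "a \<in> A" unfolding a_def using assms(1) by (meson LeastI ex_in_conv)
  have B0: "0 \<le> B" using B[OF a a] by simp
  have sub: "A \<subseteq> {a..a + nat \<lfloor>B\<rfloor>}"
  proof
    fix x assume x: "x \<in> A"
    have "a \<le> x" unfolding a_def using x by (rule Least_le)
    moreover have "real x - real a \<le> B" using B[OF x a] by linarith
    then have "int x - int a \<le> \<lfloor>B\<rfloor>" by (simp add: le_floor_iff)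
    ultimately show "x \<in> {a..a + nat \<lfloor>B\<rfloor>}" by auto
  qed
  then have "card A \<le> nat \<lfloor>B\<rfloor> + 1" using card_mono[OF _ sub] by simp
  moreover have "real (nat \<lfloor>B\<rfloor>) \<le> B" using B0 by simp
  ultimately have "real (card A) \<le> B + 1" by linarith
  then show ?thesis using finite_subset[OF sub] by simp
qed

lemma card_fun_spread_le:
  fixes T :: "('n::finite \<Rightarrow> nat) set"
  assumes "T \<noteq> {}"
    and B: "\<And>x y i. x \<in> T \<Longrightarrow> y \<in> T \<Longrightarrow> \<bar>real (x i) - real (y i)\<bar> \<le> B i"
  shows "real (card T) \<le> (\<Prod>i\<in>UNIV. B i + 1)"
proof -
  define A where "A i = (\<lambda>x. x i) ` T" for i
  have A: "finite (A i) \<and> real (card (A i)) \<le> B i + 1" for i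
    unfolding A_def using assms by (intro card_nat_spread_le) auto
  have "T \<subseteq> PiE UNIV A" by (auto simp: A_def)
  then have "card T \<le> card (PiE UNIV A)"
    using A by (intro card_mono finite_PiE) auto
  also have "\<dots> = (\<Prod>i\<in>UNIV. card (A i))" by (simp add: card_PiE)
  finally have "real (card T) \<le> (\<Prod>i\<in>UNIV. real (card (A i)))"
    by (simp flip: of_nat_prod)
  also have "\<dots> \<le> (\<Prod>i\<in>UNIV. B i + 1)" using A by (intro prod_mono) auto
  finally show ?thesis .
qed

lemma nat_floor_ge_half:
  fixes x :: real
  assumes "1 \<le> x" shows "x / 2 \<le> real (nat \<lfloor>x\<rfloor>)"
proof -
  have "1 \<le> \<lfloor>x\<rfloor>" using assms by simp
  then have "real (nat \<lfloor>x\<rfloor>) = of_int \<lfloor>x\<rfloor>" by simp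
  moreover have "x < of_int \<lfloor>x\<rfloor> + 1" by linarith
  moreover have "(1::real) \<le> of_int \<lfloor>x\<rfloor>" using assms by simp
  ultimately show ?thesis by linarith
qed

lemma prod_UNIV_remove:
  fixes g :: "'n::finite \<Rightarrow> real"
  assumes "\<And>i. i \<noteq> k \<Longrightarrow> g i = c"
  shows "(\<Prod>i\<in>UNIV. g i) = g k * c ^ (CARD('n) - 1)"
proof -
  have "(\<Prod>i\<in>UNIV. g i) = g k * (\<Prod>i\<in>UNIV - {k}. g i)" by (subst prod.remove[of _ k]) auto
  also have "(\<Prod>i\<in>UNIV - {k}. g i) = (\<Prod>i\<in>UNIV - {k}. c)" using assms by (intro prod.cong) auto
  finally show ?thesis by simp
qed

text \<open>The \<open>k\<close>-th coordinate of \<open>f j\<close> plays the role of the functional used at stage \<open>j\<close>. The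
  constant \<open>b\<close> is a parameter because a definition of it would not mention the type \<open>'n\<close>.\<close>

locale slab_tree =
  fixes k :: "'n::finite" and f :: "nat \<Rightarrow> real ^ 'n \<Rightarrow> real ^ 'n" and \<alpha> b :: real
  assumes orth: "\<And>j. orthogonal_transformation (f j)"
    and alpha: "0 \<le> \<alpha>" "\<alpha> \<le> 1"
    and b_eq: "b = 1 / (16 * real CARD('n))"
begin

text \<open>Positive even for \<open>\<alpha> = 0\<close>, so that \<open>gap j = scale (Suc j) powr expo j\<close> can be solved for the
  next scale; it tends to \<open>\<alpha>\<close>.\<close>

definition expo :: "nat \<Rightarrow> real" where
  "expo j = max \<alpha> (1 / real (Suc j))"

text \<open>The base of \<open>powr\<close> is \<open>gap j\<close>, which can be named only after
  the recursion: the gap is fixed first, as a power of the current scale, and the thickness is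
  solved from it.\<close>

primrec scale :: "nat \<Rightarrow> real" where
  "scale 0 = 1"
| "scale (Suc j) = ((b * scale j) ^ (j + 2)) powr (1 / expo j)"

definition gap :: "nat \<Rightarrow> real" where
  "gap j = (b * scale j) ^ (j + 2)"

text \<open>Children are thinned out only in direction \<open>k\<close>; elsewhere neighbours are
  one next scale apart, so that a stage loses no more than its slab condition.\<close>

definition spacing :: "nat \<Rightarrow> 'n \<Rightarrow> real" where
  "spacing j i = (if i = k then gap j else scale (Suc j))"

definition num :: "nat \<Rightarrow> 'n \<Rightarrow> nat" where
  "num j i = nat \<lfloor>b * scale j / spacing j i\<rfloor>"

definition offsets :: "nat \<Rightarrow> ('n \<Rightarrow> nat) set" where
  "offsets j = PiE UNIV (\<lambda>i. {..<num j i})"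

text \<open>Rounding the \<open>k\<close>-th coordinate makes every center of stage \<open>j + 1\<close> lie on a hyperplane
  \<open>f j x $ k \<in> gap j \<int>\<close>, while all centers keep the same number of children.\<close>

definition base :: "nat \<Rightarrow> real ^ 'n \<Rightarrow> 'n \<Rightarrow> real" where
  "base j c i = (if i = k then gap j * of_int \<lfloor>f j c $ k / gap j\<rfloor> else f j c $ i)"

definition child :: "nat \<Rightarrow> real ^ 'n \<Rightarrow> ('n \<Rightarrow> nat) \<Rightarrow> real ^ 'n" where
  "child j c n = inv (f j) (\<chi> i. base j c i + spacing j i * real (n i))"

primrec centers :: "nat \<Rightarrow> (real ^ 'n) set" where
  "centers 0 = {0}"
| "centers (Suc j) = (\<lambda>(c, n). child j c n) ` (centers j \<times> offsets j)"

definition stage :: "nat \<Rightarrow> (real ^ 'n) set" where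
  "stage j = (\<Union>c\<in>centers j. cball c (scale j / 4))"

definition E :: "(real ^ 'n) set" where
  "E = (\<Inter>j. stage j)"

text \<open>Stands in for the mass of \<open>U\<close>. All centers of a stage have equally many
  children, so the uniform distributions of different stages are consistent up to the displacement
  of a child from its parent.\<close>

definition share :: "nat \<Rightarrow> (real ^ 'n) set \<Rightarrow> real" where
  "share j U = real (card (centers j \<inter> U)) / real (card (centers j))"

section \<open>Sizes of scales, gaps and families of children\<close>

lemma expo: "0 < expo j" "expo j \<le> 1" "\<alpha> \<le> expo j"
  using alpha by (auto simp: expo_def less_max_iff_disj)

lemma b: "0 < b" "b \<le> 1 / 16"
  by (auto simp: b_eq field_simps)

lemma scale_Suc: "scale (Suc j) = gap j powr (1 / expo j)"
  by (simp add: gap_def)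

lemma gap_eq: "0 < gap j \<Longrightarrow> gap j = scale (Suc j) powr expo j"
  unfolding scale_Suc powr_powr using expo[of j] by simp

declare scale.simps(2) [simp del]

lemma scale_bounds: "0 < scale j \<and> scale j \<le> 1"
proof (induction j)
  case (Suc j)
  have bD: "0 < b * scale j" "b * scale j \<le> 1"
    using Suc b mult_mono[of b 1 "scale j" 1] by auto
  then have gap: "0 < gap j" unfolding gap_def by simp
  have "gap j \<le> 1" unfolding gap_def by (rule power_le_one) (use bD in auto)
  have "gap j powr (1 / expo j) \<le> 1 powr (1 / expo j)"
    using gap \<open>gap j \<le> 1\<close> expo[of j] by (intro powr_mono2) auto
  then show ?case using gap by (simp add: scale_Suc)
qed simp

lemma scale_pos: "0 < scale j" and scale_le_1: "scale j \<le> 1"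
  using scale_bounds by auto

lemma bD: "0 < b * scale j" "b * scale j \<le> 1"
  using scale_bounds[of j] b mult_mono[of b 1 "scale j" 1] by auto

lemma gap_pos: "0 < gap j"
  using bD by (simp add: gap_def)

lemma gap_le: "gap j \<le> b * scale j"
proof -
  have "(b * scale j) ^ (j + 2) \<le> (b * scale j) ^ 1" using bD[of j] by (intro power_decreasing) auto
  then show ?thesis unfolding gap_def power_one_right .
qed

lemma gap_le_power: "gap j \<le> scale j ^ (j + 2)"
  unfolding gap_def using b scale_pos[of j] bD[of j]
  by (intro power_mono) (auto simp: mult_le_cancel_right1)

lemma gap_le_1: "gap j \<le> 1"
  using gap_le[of j] bD[of j] by linarith

lemma scale_Suc_le_gap: "scale (Suc j) \<le> gap j"
proof -
  have "scale (Suc j) \<le> gap j powr 1"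
    unfolding scale_Suc using gap_pos[of j] gap_le_1[of j] expo[of j]
    by (intro powr_mono') auto
  then show ?thesis using gap_pos[of j] by simp
qed

lemma scale_Suc_le: "scale (Suc j) \<le> scale j / 16"
proof -
  have "b * scale j \<le> (1 / 16) * scale j" using b scale_pos[of j] by (intro mult_right_mono) auto
  then show ?thesis using scale_Suc_le_gap[of j] gap_le[of j] by linarith
qed

lemma scale_le_power: "scale j \<le> (1 / 16) ^ j"
proof (induction j)
  case (Suc j)
  then show ?case using scale_Suc_le[of j] by simp
qed simp

lemma scale_decseq: "i \<le> j \<Longrightarrow> scale j \<le> scale i"
proof (induction rule: dec_induct)
  case (step n)
  then show ?case using scale_Suc_le[of n] scale_pos[of n] by linarith
qed simp

lemma scale_tendsto_0: "scale \<longlonglongrightarrow> 0"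
  by (rule tendsto_sandwich[of "\<lambda>_. 0" _ _ "\<lambda>j. (1 / 16) ^ j"])
    (auto simp: scale_le_power less_imp_le[OF scale_pos] intro!: LIMSEQ_power_zero always_eventually)

lemma spacing_bounds: "scale (Suc j) \<le> spacing j i" "spacing j i \<le> gap j" "spacing j i \<le> b * scale j" "0 < spacing j i"
  using scale_Suc_le_gap[of j] gap_le[of j] scale_pos[of "Suc j"] gap_pos[of j] by (auto simp: spacing_def)

lemma num_ge: "b * scale j / (2 * spacing j i) \<le> real (num j i)"
  using nat_floor_ge_half[of "b * scale j / spacing j i"] spacing_bounds[of j i]
  by (simp add: num_def field_simps)

lemma finite_offsets: "finite (offsets j)"
  unfolding offsets_def by (intro finite_PiE) auto

lemma card_offsets_ge: "(\<Prod>i\<in>UNIV. b * scale j / (2 * spacing j i)) \<le> real (card (offsets j))"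
proof -
  have "(\<Prod>i\<in>UNIV. b * scale j / (2 * spacing j i)) \<le> (\<Prod>i\<in>UNIV. real (num j i))"
    using num_ge bD[of j] spacing_bounds by (intro prod_mono) (auto simp: less_imp_le)
  then show ?thesis by (simp add: offsets_def card_PiE)
qed

lemma card_offsets_pos: "0 < card (offsets j)"
proof -
  have "0 < (\<Prod>i\<in>UNIV. b * scale j / (2 * spacing j i))"
    using bD spacing_bounds by (intro prod_pos) auto
  then show ?thesis using card_offsets_ge[of j] by linarith
qed

section \<open>Position and separation of the centers\<close>

lemma f_child: "f j (child j c n) = (\<chi> i. base j c i + spacing j i * real (n i))"
  unfolding child_def by (rule surj_f_inv_f[OF orthogonal_transformation_surj[OF orth]])

lemma f_dist: "norm (f j x - f j y) = dist x y"
  using orthogonal_transformation_norm[OF orth, of j "x - y"]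
    linear_diff[OF orthogonal_transformation_linear[OF orth], of j x y]
  by (simp add: dist_norm)

lemma f_dist_component: "\<bar>f j x $ i - f j y $ i\<bar> \<le> dist x y"
  using component_le_norm_cart[of "f j x - f j y" i] by (simp add: f_dist)

text \<open>Offset and rounding each move a coordinate by at most \<open>b * scale j\<close>. The
  value of \<open>b\<close> makes the sum over all coordinates \<open>scale j / 8\<close>, small
  enough to keep all later stages within \<open>scale j / 4\<close> of the center and the children
  of different centers apart.\<close>

lemma child_near:
  assumes "n \<in> offsets j"
  shows "dist (child j c n) c \<le> scale j / 8"
proof -
  have "dist (child j c n) c = norm (f j (child j c n) - f j c)" by (simp add: f_dist)
  also have "\<dots> \<le> (\<Sum>i\<in>UNIV. \<bar>(f j (child j c n) - f j c) $ i\<bar>)" by (rule norm_le_l1_cart)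
  also have "\<dots> \<le> (\<Sum>i\<in>(UNIV::'n set). 2 * (b * scale j))"
  proof (rule sum_mono)
    fix i
    have "real (n i) \<le> b * scale j / spacing j i"
    proof -
      have "n i < num j i" using assms by (auto simp: offsets_def PiE_def)
      moreover have "real (num j i) \<le> b * scale j / spacing j i"
        unfolding num_def using bD[of j] spacing_bounds[of j i] by (simp add: less_imp_le)
      ultimately show ?thesis by linarith
    qed
    then have "spacing j i * real (n i) \<le> b * scale j" using spacing_bounds[of j i] by (simp add: field_simps)
    moreover have "0 \<le> spacing j i * real (n i)" using spacing_bounds[of j i] by simp
    moreover have "\<bar>base j c i - f j c $ i\<bar> \<le> b * scale j"
    proof (cases "i = k")
      case True
      let ?x = "f j c $ k / gap j"
      have "\<bar>of_int \<lfloor>?x\<rfloor> - ?x\<bar> \<le> 1" by linarith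
      then have "gap j * \<bar>of_int \<lfloor>?x\<rfloor> - ?x\<bar> \<le> gap j * 1" using gap_pos[of j] by (intro mult_left_mono) auto
      moreover have "gap j * \<bar>of_int \<lfloor>?x\<rfloor> - ?x\<bar> = \<bar>gap j * (of_int \<lfloor>?x\<rfloor> - ?x)\<bar>"
        using gap_pos[of j] by (simp add: abs_mult)
      moreover have "gap j * (of_int \<lfloor>?x\<rfloor> - ?x) = base j c k - f j c $ k"
        using gap_pos[of j] by (simp add: base_def right_diff_distrib)
      ultimately show ?thesis using True gap_le[of j] by simp
    next
      case False
      then show ?thesis using bD[of j] by (simp add: base_def)
    qed
    ultimately show "\<bar>(f j (child j c n) - f j c) $ i\<bar> \<le> 2 * (b * scale j)"
      unfolding f_child by (simp add: abs_le_iff)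
  qed
  also have "\<dots> = scale j / 8" by (simp add: b_eq)
  finally show ?thesis .
qed

lemma child_diff:
  "\<bar>f j (child j c n) $ i - f j (child j c n') $ i\<bar> = spacing j i * \<bar>real (n i) - real (n' i)\<bar>"
proof -
  have "f j (child j c n) $ i - f j (child j c n') $ i = spacing j i * (real (n i) - real (n' i))"
    by (simp add: f_child right_diff_distrib)
  then show ?thesis using spacing_bounds[of j i] by (simp add: abs_mult)
qed

lemma child_sep:
  assumes "n \<noteq> n'"
  shows "scale (Suc j) \<le> dist (child j c n) (child j c n')"
proof -
  obtain i where "n i \<noteq> n' i" using assms by blast
  then have "1 \<le> \<bar>real (n i) - real (n' i)\<bar>" by linarith
  then have "spacing j i * 1 \<le> spacing j i * \<bar>real (n i) - real (n' i)\<bar>"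
    using spacing_bounds[of j i] by (intro mult_left_mono) auto
  then show ?thesis
    using spacing_bounds[of j i] child_diff[of j c n i n'] f_dist_component[of j "child j c n" i "child j c n'"]
    by linarith
qed

text \<open>Siblings are separated by their grid. Children of different parents lose at most
  \<open>scale j / 4\<close> of the parents' distance, which leaves far more than
  \<open>scale (Suc j) \<le> scale j / 16\<close>.\<close>

lemma centers_sep: "c \<in> centers j \<Longrightarrow> c' \<in> centers j \<Longrightarrow> c \<noteq> c' \<Longrightarrow> scale j \<le> dist c c'"
proof (induction j arbitrary: c c')
  case (Suc j)
  obtain a n a' n' where a: "c = child j a n" "a \<in> centers j" "n \<in> offsets j"
    "c' = child j a' n'" "a' \<in> centers j" "n' \<in> offsets j"
    using Suc.prems by auto
  show ?case
  proof (cases "a = a'")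
    case True
    then show ?thesis using a Suc.prems(3) child_sep[of n n' j a] by auto
  next
    case False
    then have "scale j \<le> dist a a'" using Suc.IH a by blast
    moreover have "dist a a' \<le> dist a c + dist c c' + dist c' a'"
      using dist_triangle[of a a' c] dist_triangle[of c a' c'] by linarith
    ultimately have "scale j \<le> scale j / 8 + dist c c' + scale j / 8"
      using child_near[OF a(3), of a] child_near[OF a(6), of a'] a
      by (simp add: dist_commute)
    then show ?thesis using scale_Suc_le[of j] scale_pos[of j] by linarith
  qed
qed simp

lemma finite_centers: "finite (centers j)"
  by (induction j) (auto simp: finite_offsets)

lemma inj_child: "inj_on (\<lambda>(c, n). child j c n) (centers j \<times> offsets j)"
proof (rule inj_onI, clarify)
  fix a n a' n'
  assume *: "a \<in> centers j" "n \<in> offsets j" "a' \<in> centers j" "n' \<in> offsets j" "child j a n = child j a' n'"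
  have "dist a a' \<le> dist (child j a n) a + dist (child j a' n') a'"
    using dist_triangle3[of a a' "child j a n"] *(5) by simp
  then have "dist a a' < scale j"
    using child_near[OF *(2), of a] child_near[OF *(4), of a'] scale_pos[of j] by linarith
  then have "a = a'" using centers_sep *(1,3) by force
  moreover have "n = n'"
  proof (rule ccontr)
    assume "n \<noteq> n'"
    then show False using child_sep[of n n' j a] *(5) \<open>a = a'\<close> scale_pos[of "Suc j"] by simp
  qed
  ultimately show "a = a' \<and> n = n'" by simp
qed

lemma card_centers_Suc: "card (centers (Suc j)) = card (centers j) * card (offsets j)"
  by (simp add: card_image[OF inj_child] card_cartesian_product)

lemma card_centers_pos: "0 < card (centers j)"
  by (induction j) (auto simp: card_centers_Suc card_offsets_pos simp del: centers.simps(2))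

section \<open>Distribution of mass by counting centers\<close>

lemma share_step: "share (Suc j) U \<le> share j {x. \<exists>u\<in>U. dist x u \<le> scale j / 8}"
proof -
  let ?U = "{x. \<exists>u\<in>U. dist x u \<le> scale j / 8}"
  have "centers (Suc j) \<inter> U \<subseteq> (\<lambda>(c, n). child j c n) ` ((centers j \<inter> ?U) \<times> offsets j)"
  proof
    fix x assume x: "x \<in> centers (Suc j) \<inter> U"
    then obtain c n where "c \<in> centers j" "n \<in> offsets j" "x = child j c n" by auto
    moreover from this have "dist c x \<le> scale j / 8" using child_near[of n j c] by (simp add: dist_commute)
    ultimately show "x \<in> (\<lambda>(c, n). child j c n) ` ((centers j \<inter> ?U) \<times> offsets j)" using x by force
  qed
  then have "card (centers (Suc j) \<inter> U) \<le> card ((\<lambda>(c, n). child j c n) ` ((centers j \<inter> ?U) \<times> offsets j))"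
    using finite_centers finite_offsets by (intro card_mono) auto
  also have "\<dots> \<le> card ((centers j \<inter> ?U) \<times> offsets j)" using finite_centers finite_offsets by (intro card_image_le) auto
  also have "\<dots> = card (centers j \<inter> ?U) * card (offsets j)" by (rule card_cartesian_product)
  finally have "real (card (centers (Suc j) \<inter> U)) \<le> real (card (centers j \<inter> ?U)) * real (card (offsets j))"
    by (simp flip: of_nat_mult)
  then show ?thesis
    unfolding share_def card_centers_Suc using card_centers_pos[of j] card_offsets_pos[of j]
    by (simp add: field_simps)
qed

lemma share_mono: "U \<subseteq> W \<Longrightarrow> share j U \<le> share j W"
  unfolding share_def using finite_centers
  by (intro divide_right_mono) (auto intro!: card_mono)

text \<open>Ancestors are displaced by a geometrically decreasing sum: \<open>scale j / 8\<close>
  for one generation, and the remaining \<open>scale j / 8\<close> pays for all later ones.\<close>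

lemma share_nbhd:
  assumes "j \<le> i"
  shows "share i U \<le> share j {x. \<exists>u\<in>U. dist x u \<le> scale j / 4}"
  using assms
proof (induction rule: inc_induct)
  case base
  have "U \<subseteq> {x. \<exists>u\<in>U. dist x u \<le> scale i / 4}" using scale_pos[of i] by force
  then show ?case by (rule share_mono)
next
  case (step j)
  let ?W = "{x. \<exists>u\<in>U. dist x u \<le> scale (Suc j) / 4}"
  have "share i U \<le> share (Suc j) ?W" by (rule step.IH)
  also have "\<dots> \<le> share j {x. \<exists>u\<in>?W. dist x u \<le> scale j / 8}" by (rule share_step)
  also have "\<dots> \<le> share j {x. \<exists>u\<in>U. dist x u \<le> scale j / 4}"
  proof (rule share_mono, clarify)
    fix x w u assume *: "dist x w \<le> scale j / 8" "u \<in> U" "dist w u \<le> scale (Suc j) / 4"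
    then have "dist x u \<le> scale j / 4"
      using dist_triangle[of x u w] scale_Suc_le[of j] scale_pos[of j] by linarith
    then show "\<exists>u\<in>U. dist x u \<le> scale j / 4" using * by blast
  qed
  finally show ?case .
qed

text \<open>A set of diameter well below \<open>scale j\<close> meets the children of one center
  only, and these form a grid. Direction \<open>k\<close> contributes \<open>r\<close> plus the gap;
  in the other directions the spacing is at most \<open>4 * r\<close>, whence
  \<open>14 = 6 + 2 * 4\<close>.\<close>

lemma share_Suc_le:
  assumes W: "\<And>x y. x \<in> W \<Longrightarrow> y \<in> W \<Longrightarrow> dist x y \<le> \<rho>"
    and \<rho>: "\<rho> + scale j / 4 < scale j" "\<rho> \<le> 3 * r" and r: "scale (Suc j) \<le> 4 * r"
  shows "share (Suc j) W \<le>
    (6 * r + 2 * gap j) / (b * scale j) * (14 * r / (b * scale j)) ^ (CARD('n) - 1) / real (card (centers j))"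
    (is "_ \<le> ?R")
proof (cases "centers (Suc j) \<inter> W = {}")
  case True
  have "0 \<le> r" using r scale_pos[of "Suc j"] by linarith
  then show ?thesis using True bD[of j] gap_pos[of j] by (simp add: share_def)
next
  case False
  then obtain c m where cm: "c \<in> centers j" "m \<in> offsets j" "child j c m \<in> W" by auto
  define T where "T = {n \<in> offsets j. child j c n \<in> W}"
  have "centers (Suc j) \<inter> W \<subseteq> child j c ` T"
  proof
    fix x assume x: "x \<in> centers (Suc j) \<inter> W"
    then obtain a n where a: "a \<in> centers j" "n \<in> offsets j" "x = child j a n" by auto
    have "dist a c \<le> dist a x + dist x (child j c m) + dist (child j c m) c"
      using dist_triangle[of a c x] dist_triangle[of x c "child j c m"] by linarith
    also have "\<dots> \<le> scale j / 8 + \<rho> + scale j / 8"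
      using child_near[OF a(2), of a] child_near[OF cm(2), of c] W[of x "child j c m"] x cm a
      by (simp add: dist_commute)
    finally have "dist a c < scale j" using \<rho>(1) by linarith
    then have "a = c" using centers_sep a(1) cm(1) by force
    then show "x \<in> child j c ` T" using a x by (auto simp: T_def)
  qed
  moreover have finT: "finite T" using finite_offsets by (simp add: T_def)
  ultimately have "card (centers (Suc j) \<inter> W) \<le> card T"
    by (meson card_image_le card_mono finite_imageI order_trans)
  moreover have "real (card T) \<le> (\<Prod>i\<in>UNIV. 3 * r / spacing j i + 1)"
  proof (rule card_fun_spread_le)
    show "T \<noteq> {}" using cm by (auto simp: T_def)
    fix n n' i assume "n \<in> T" "n' \<in> T"
    then have "dist (child j c n) (child j c n') \<le> 3 * r"
      using W \<rho>(2) by (force simp: T_def)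
    then have "spacing j i * \<bar>real (n i) - real (n' i)\<bar> \<le> 3 * r"
      using child_diff[of j c n i n'] f_dist_component[of j "child j c n" i "child j c n'"] by linarith
    then show "\<bar>real (n i) - real (n' i)\<bar> \<le> 3 * r / spacing j i"
      using spacing_bounds[of j i] by (simp add: field_simps)
  qed
  ultimately have "real (card (centers (Suc j) \<inter> W)) \<le> (\<Prod>i\<in>UNIV. 3 * r / spacing j i + 1)" by linarith
  moreover have "(\<Prod>i\<in>UNIV. 3 * r / spacing j i + 1)
      \<le> (6 * r + 2 * gap j) / (b * scale j) * (14 * r / (b * scale j)) ^ (CARD('n) - 1) * real (card (offsets j))"
  proof -
    \<comment> \<open>Each factor is split so that its second part is the lower bound for the number
      of children in that direction; the product of these parts is at most
      \<open>card (offsets j)\<close>.\<close>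
    define g where "g i = (6 * r + 2 * spacing j i) / (b * scale j)" for i
    define g' where "g' i = (if i = k then (6 * r + 2 * gap j) / (b * scale j) else 14 * r / (b * scale j))" for i
    have r0: "0 < r" using r scale_pos[of "Suc j"] by linarith
    have "(\<Prod>i\<in>UNIV. 3 * r / spacing j i + 1) = (\<Prod>i\<in>UNIV. g i * (b * scale j / (2 * spacing j i)))"
    proof (rule prod.cong[OF refl])
      fix i
      have "3 * r / x + 1 = (6 * r + 2 * x) / B * (B / (2 * x))" if "0 < B" "0 < x" for B x :: real
        using that by (simp add: field_simps)
      then show "3 * r / spacing j i + 1 = g i * (b * scale j / (2 * spacing j i))"
        unfolding g_def using bD(1) spacing_bounds(4) .
    qed
    also have "\<dots> = (\<Prod>i\<in>UNIV. g i) * (\<Prod>i\<in>UNIV. b * scale j / (2 * spacing j i))" by (rule prod.distrib)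
    also have "\<dots> \<le> (\<Prod>i\<in>UNIV. g' i) * real (card (offsets j))"
    proof (intro mult_mono card_offsets_ge prod_mono)
      fix i
      show "0 \<le> g i \<and> g i \<le> g' i"
        unfolding g_def g'_def spacing_def using r r0 bD[of j] gap_pos[of j] scale_pos[of "Suc j"]
        by (auto intro!: divide_right_mono)
      show "0 \<le> prod g' UNIV"
        unfolding g'_def using r0 bD[of j] gap_pos[of j] by (intro prod_nonneg) auto
      show "0 \<le> (\<Prod>i\<in>UNIV. b * scale j / (2 * spacing j i))"
        using bD[of j] spacing_bounds(4)[of j] by (intro prod_nonneg) (auto simp: less_imp_le)
    qed
    also have "(\<Prod>i\<in>UNIV. g' i) = (6 * r + 2 * gap j) / (b * scale j) * (14 * r / (b * scale j)) ^ (CARD('n) - 1)"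
      by (subst prod_UNIV_remove[where k = k and c = "14 * r / (b * scale j)"]) (auto simp: g'_def)
    finally show ?thesis .
  qed
  ultimately have *: "real (card (centers (Suc j) \<inter> W)) \<le> (6 * r + 2 * gap j) / (b * scale j)
      * (14 * r / (b * scale j)) ^ (CARD('n) - 1) * real (card (offsets j))" by linarith
  show ?thesis
    unfolding share_def card_centers_Suc of_nat_mult
    using divide_right_mono[OF *, of "real (card (centers j)) * real (card (offsets j))"] card_offsets_pos[of j]
    by simp
qed

text \<open>All generations before the last are counted as a single center. The loss is a power of
  \<open>scale i\<close>, affordable since the next scale is far smaller.\<close>

lemma card_centers_Suc_ge:
  "(b * scale i / 2) ^ CARD('n) / (gap i * scale (Suc i) ^ (CARD('n) - 1)) \<le> real (card (centers (Suc i)))"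
proof -
  obtain q where q: "CARD('n) = Suc q" by (metis zero_less_card_finite gr0_implies_Suc)
  have "(b * scale i / 2) ^ CARD('n) / (gap i * scale (Suc i) ^ (CARD('n) - 1))
      = b * scale i / (2 * gap i) * (b * scale i / (2 * scale (Suc i))) ^ (CARD('n) - 1)"
    by (simp add: q power_divide power_mult_distrib)
  also have "\<dots> = (\<Prod>j\<in>UNIV. b * scale i / (2 * spacing i j))"
    by (subst prod_UNIV_remove[where k = k and c = "b * scale i / (2 * scale (Suc i))"]) (auto simp: spacing_def)
  also have "\<dots> \<le> real (card (offsets i))" by (rule card_offsets_ge)
  also have "\<dots> \<le> real (card (centers (Suc i)))"
    unfolding card_centers_Suc using card_centers_pos[of i] mult_right_mono[of 1 "real (card (centers i))"] by simp
  finally show ?thesis .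
qed

end

text \<open>A small gain \<open>g\<close> in the exponent pays for any fixed power \<open>q\<close>
  of an earlier scale once \<open>n\<close> is at least \<open>q / g\<close>.\<close>

lemma powr_le_power_if_le_power:
  fixes r x g :: real
  assumes "0 < r" "r \<le> x ^ n" "0 < x" "x \<le> 1" "0 < g" "real q \<le> real n * g"
  shows "r powr g \<le> x ^ q"
proof -
  have "r powr g \<le> (x ^ n) powr g" using assms by (intro powr_mono2) auto
  also have "\<dots> = x powr (real n * g)" using assms by (simp add: powr_powr flip: powr_realpow)
  also have "\<dots> \<le> x powr real q" using assms by (intro powr_mono') auto
  finally show ?thesis using assms by (simp add: powr_realpow)
qed

context slab_tree
begin

text \<open>For \<open>r\<close> between two consecutive scales, \<open>share_Suc_le\<close> gives a bound of order \<open>r powr (d - 1 + \<alpha>)\<close>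
  times a fixed negative power of an earlier scale. The gain \<open>r powr g\<close> absorbs that power, because
  the exponent \<open>j + 2\<close> in the definition of the scales is unbounded.\<close>

lemma share_le_powr:
  assumes t: "t < real (CARD('n) - 1) + \<alpha>"
  obtains Q J where "0 < Q"
    "\<And>j i r U. J \<le> j \<Longrightarrow> scale (Suc j) \<le> 4 * r \<Longrightarrow> 4 * r \<le> scale j \<Longrightarrow> Suc j \<le> i \<Longrightarrow>
      (\<And>x y. x \<in> U \<Longrightarrow> y \<in> U \<Longrightarrow> dist x y \<le> r) \<Longrightarrow> share i U \<le> Q * r powr t"
proof -
  define m where "m = CARD('n) - 1"
  have m: "CARD('n) = Suc m" unfolding m_def using zero_less_card_finite[where 'a = 'n] by linarith
  define g where "g = real m + \<alpha> - t"
  have g: "0 < g" using t by (simp add: g_def m_def)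
  define Q1 where "Q1 = (1 / b) * (14 / b) ^ m * (2 / b) ^ Suc m"
  have Q1: "0 < Q1" using b by (simp add: Q1_def)
  \<comment> \<open>\<open>J0\<close> is large enough to absorb both \<open>scale a ^ Suc m\<close>
    and \<open>scale j ^ (m + 2)\<close>; the extra 1 in \<open>J\<close> gives \<open>j\<close> a
    predecessor \<open>a \<ge> J0\<close>.\<close>
  obtain J0 :: nat where J0: "real (m + 2) / g \<le> real J0" by (meson real_arch_simple)
  define J where "J = Suc J0"
  have "share i U \<le> (32 * Q1) * r powr t"
    if j: "J \<le> j" and r: "scale (Suc j) \<le> 4 * r" "4 * r \<le> scale j" and i: "Suc j \<le> i"
      and U: "\<And>x y. x \<in> U \<Longrightarrow> y \<in> U \<Longrightarrow> dist x y \<le> r" for j i r U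
  proof -
    obtain a where a: "j = Suc a" using j by (cases j) (auto simp: J_def)
    have "J0 \<le> a" using j a by (simp add: J_def)
    then have "real (m + 2) / g \<le> real a" using J0 by linarith
    then have "real (m + 2) \<le> real a * g" using g by (simp add: field_simps)
    moreover have "real a * g \<le> real (a + 2) * g" "real a * g \<le> real (j + 2) * g"
      using g a by (auto intro!: mult_right_mono)
    ultimately have ag: "real (Suc m) \<le> real (a + 2) * g" "real (m + 2) \<le> real (j + 2) * g" by auto
    have r0: "0 < r" using r scale_pos[of "Suc j"] by linarith
    note Dj = scale_pos[of j] and Da = scale_pos[of a] and Sj = gap_pos[of j] and Sa = gap_pos[of a]
    have rD: "r \<le> scale j" using r(2) r0 by linarith
    have rt: "r ^ m * r powr \<alpha> = r powr t * r powr g"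
      using r0 by (simp add: g_def flip: powr_realpow powr_add)
    have Sa_le: "gap a \<le> scale j powr \<alpha>"
      unfolding a gap_eq[OF gap_pos] using scale_pos[of "Suc a"] scale_le_1[of "Suc a"] expo(3)[of a]
      by (intro powr_mono') auto
    have key: "(6 * r + 2 * gap j) * r ^ m * (gap a / (scale j * scale a ^ Suc m)) \<le> 32 * r powr t"
    proof (cases "gap j \<le> r")
      \<comment> \<open>The new slabs are not resolved: direction \<open>k\<close> contributes a
        multiple of \<open>r\<close>, and the factor \<open>r powr \<alpha>\<close> comes from the
        previous slab condition, \<open>gap a \<le> scale j powr \<alpha>\<close>, together with
        \<open>r \<le> scale j\<close>.\<close>
      case True
      have "r * (gap a / scale j) \<le> r powr \<alpha>"
      proof -
        have "r powr (1 - \<alpha>) \<le> scale j powr (1 - \<alpha>)" using r0 rD alpha by (intro powr_mono2) auto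
        then have "r powr (1 - \<alpha>) * r powr \<alpha> * gap a \<le> scale j powr (1 - \<alpha>) * r powr \<alpha> * scale j powr \<alpha>"
          using Sa_le Sa by (intro mult_mono) auto
        moreover have "r powr (1 - \<alpha>) * r powr \<alpha> = r" using r0 by (simp flip: powr_add)
        moreover have "scale j powr (1 - \<alpha>) * scale j powr \<alpha> = scale j" using Dj by (simp flip: powr_add)
        moreover have "scale j powr (1 - \<alpha>) * r powr \<alpha> * scale j powr \<alpha>
            = scale j powr (1 - \<alpha>) * scale j powr \<alpha> * r powr \<alpha>" by (simp only: mult_ac)
        ultimately have "r * gap a \<le> scale j * r powr \<alpha>" by simp
        then show ?thesis using Dj by (simp add: field_simps)
      qed
      have "r powr g \<le> scale a ^ Suc m"
        by (rule powr_le_power_if_le_power[OF r0 _ Da scale_le_1 g ag(1)])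
          (use rD scale_Suc_le_gap[of a] gap_le_power[of a] a in auto)
      have "(6 * r + 2 * gap j) * r ^ m * (gap a / (scale j * scale a ^ Suc m))
          \<le> (8 * r) * r ^ m * (gap a / (scale j * scale a ^ Suc m))"
        using True r0 Dj Da Sa by (intro mult_right_mono) auto
      also have "\<dots> = 8 * r ^ m * (r * (gap a / scale j)) / scale a ^ Suc m" by simp
      also have "\<dots> \<le> 8 * r ^ m * r powr \<alpha> / scale a ^ Suc m"
        using \<open>r * (gap a / scale j) \<le> r powr \<alpha>\<close> r0 Da by (intro divide_right_mono mult_left_mono) auto
      also have "\<dots> = 8 * r powr t * (r powr g / scale a ^ Suc m)" by (simp only: mult.assoc rt times_divide_eq_right)
      also have "\<dots> \<le> 8 * r powr t * 1"
        using \<open>r powr g \<le> scale a ^ Suc m\<close> Da by (intro mult_left_mono) (auto simp: divide_le_eq_1)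
      also have "\<dots> \<le> 32 * r powr t" by simp
      finally show ?thesis .
    next
      \<comment> \<open>A bounded number of new slabs is met, so \<open>gap j\<close> replaces
        \<open>r\<close> in direction \<open>k\<close> and supplies the factor
        \<open>r powr \<alpha>\<close>; \<open>gap a\<close> is estimated by 1.\<close>
      case False
      have "gap j \<le> 4 * r powr \<alpha>"
      proof -
        have "gap j \<le> scale (Suc j) powr \<alpha>"
          unfolding gap_eq[OF gap_pos] using scale_pos[of "Suc j"] scale_le_1[of "Suc j"] expo(3)[of j]
          by (intro powr_mono') auto
        also have "\<dots> \<le> (4 * r) powr \<alpha>" using r(1) scale_pos[of "Suc j"] alpha by (intro powr_mono2) auto
        also have "\<dots> = 4 powr \<alpha> * r powr \<alpha>" using r0 by (simp add: powr_mult)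
        also have "\<dots> \<le> 4 powr 1 * r powr \<alpha>" using alpha by (intro mult_right_mono powr_mono) auto
        finally show ?thesis by simp
      qed
      have "r powr g \<le> scale j ^ (m + 2)"
        by (rule powr_le_power_if_le_power[OF r0 _ Dj scale_le_1 g ag(2)])
          (use False gap_le_power[of j] in auto)
      have "gap a / (scale j * scale a ^ Suc m) \<le> 1 / (scale j * scale j ^ Suc m)"
        using gap_le_1[of a] Sa Dj Da scale_decseq[of a j] a
        by (intro frac_le mult_left_mono power_mono) auto
      then have "(6 * r + 2 * gap j) * r ^ m * (gap a / (scale j * scale a ^ Suc m))
          \<le> (8 * gap j) * r ^ m * (1 / (scale j * scale j ^ Suc m))"
        using False r0 Sj Sa Dj Da by (intro mult_mono) auto
      also have "\<dots> \<le> (8 * (4 * r powr \<alpha>)) * r ^ m * (1 / (scale j * scale j ^ Suc m))"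
        using \<open>gap j \<le> 4 * r powr \<alpha>\<close> r0 Dj by (intro mult_right_mono) auto
      also have "\<dots> = 32 * (r ^ m * r powr \<alpha>) / scale j ^ (m + 2)" by (simp add: mult_ac)
      also have "\<dots> = 32 * r powr t * (r powr g / scale j ^ (m + 2))" by (simp only: mult.assoc rt times_divide_eq_right)
      also have "\<dots> \<le> 32 * r powr t * 1"
        using \<open>r powr g \<le> scale j ^ (m + 2)\<close> Dj by (intro mult_left_mono) (auto simp: divide_le_eq_1)
      finally show ?thesis by simp
    qed
    let ?W = "{x. \<exists>u\<in>U. dist x u \<le> scale (Suc j) / 4}"
    have "share i U \<le> share (Suc j) ?W" using i by (rule share_nbhd)
    also have "\<dots> \<le> (6 * r + 2 * gap j) / (b * scale j) * (14 * r / (b * scale j)) ^ (CARD('n) - 1) / real (card (centers j))"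
    proof (rule share_Suc_le)
      fix x y assume "x \<in> ?W" "y \<in> ?W"
      then obtain u v where uv: "u \<in> U" "v \<in> U" "dist x u \<le> scale (Suc j) / 4" "dist y v \<le> scale (Suc j) / 4" by auto
      have "dist x y \<le> dist x u + dist u v + dist y v"
        using dist_triangle[of x y u] dist_triangle[of u y v] by (simp add: dist_commute)
      \<comment> \<open>The neighbourhood adds \<open>scale (Suc j) / 2 \<le> 2 * r\<close>, which
        gives the bound \<open>3 * r\<close>.\<close>
      then show "dist x y \<le> r + scale (Suc j) / 2" using U[OF uv(1,2)] uv by linarith
    qed (use r r0 scale_Suc_le[of j] Dj in linarith)+
    also have "\<dots> \<le> (6 * r + 2 * gap j) / (b * scale j) * (14 * r / (b * scale j)) ^ m
        / ((b * scale a / 2) ^ Suc m / (gap a * scale j ^ m))"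
      (is "?X / ?c \<le> _ / ?q")
    proof -
      have qc: "?q \<le> ?c" using card_centers_Suc_ge[of a] unfolding a[symmetric] m diff_Suc_1 .
      have q: "0 < ?q" using b Da Dj Sa by simp
      then have c: "0 < ?c" using qc by linarith
      have "0 \<le> ?X" using b Dj Sj r0 by simp
      then show ?thesis
        unfolding m_def[symmetric] by (rule divide_left_mono[OF qc _ mult_pos_pos[OF c q]])
    qed
    also have "\<dots> = Q1 * ((6 * r + 2 * gap j) * r ^ m * (gap a / (scale j * scale a ^ Suc m)))"
    proof -
      have *: "X / (b * d) * (14 * r / (b * d)) ^ m / ((b * d' / 2) ^ Suc m / (s * d ^ m))
        = Q1 * (X * r ^ m * (s / (d * d' ^ Suc m)))" if "0 < d" "0 < d'" for X d d' s
        unfolding Q1_def using that b(1) by (simp add: power_divide power_mult_distrib field_simps)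
      show ?thesis by (rule *[OF Dj Da])
    qed
    also have "\<dots> \<le> Q1 * (32 * r powr t)" using key Q1 by (intro mult_left_mono) auto
    finally show ?thesis by simp
  qed
  then show ?thesis using Q1 that[of "32 * Q1" J] by auto
qed

section \<open>The limit set and its positive measure\<close>

lemma compact_stage: "compact (stage j)"
  unfolding stage_def using finite_centers by (intro compact_UN) auto

lemma centers_subset_stage: "centers j \<subseteq> stage j"
  using scale_pos[of j] by (force simp: stage_def)

lemma stage_Suc_subset: "stage (Suc j) \<subseteq> stage j"
proof
  fix x assume "x \<in> stage (Suc j)"
  then obtain c n where c: "c \<in> centers j" "n \<in> offsets j" "dist (child j c n) x \<le> scale (Suc j) / 4"
    by (auto simp: stage_def)
  then have "dist c x \<le> scale j / 4"
    using dist_triangle[of c x "child j c n"] child_near[OF c(2), of c] scale_Suc_le[of j] scale_pos[of j]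
    by (simp add: dist_commute)
  then show "x \<in> stage j" using c(1) by (auto simp: stage_def)
qed

lemma stage_antimono: "i \<le> j \<Longrightarrow> stage j \<subseteq> stage i"
  by (induction rule: dec_induct) (use stage_Suc_subset in auto)

lemma centers_nonempty: "centers j \<noteq> {}"
  using card_centers_pos[of j] by auto

lemma E_nonempty: "E \<noteq> {}"
  unfolding E_def
  by (rule compact_nest) (use compact_stage centers_nonempty centers_subset_stage stage_antimono in blast)+

lemma compact_E: "compact E"
  unfolding E_def using compact_stage by (intro compact_Inter) auto

text \<open>The compact sets \<open>stage l - W\<close> decrease and have empty intersection, so one
  of them is empty. This turns an open cover of \<open>E\<close> into a cover of a stage, where
  centers can be counted.\<close>

lemma stage_subset_open:
  assumes "open W" "E \<subseteq> W"
  obtains l where "stage l \<subseteq> W"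
proof (rule ccontr)
  assume "\<not> thesis"
  then have ne: "stage l - W \<noteq> {}" for l using that by blast
  have "\<Inter>(range (\<lambda>l. stage l - W)) \<noteq> {}"
  proof (rule compact_nest)
    show "compact (stage l - W)" for l by (rule compact_diff[OF compact_stage assms(1)])
    show "stage j - W \<subseteq> stage i - W" if "i \<le> j" for i j using stage_antimono[OF that] by blast
  qed (rule ne)
  then show False using assms(2) by (auto simp: E_def)
qed

lemma scale_exists:
  assumes "0 < r" "r \<le> scale J"
  obtains j where "J \<le> j" "scale (Suc j) \<le> r" "r \<le> scale j"
proof -
  have "eventually (\<lambda>j. scale j < r) sequentially" using scale_tendsto_0 assms(1) by (rule order_tendstoD)
  then obtain l where l: "scale l < r" by (auto simp: eventually_sequentially)
  have "\<exists>j\<ge>J. scale (Suc j) \<le> r \<and> r \<le> scale j"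
  proof (rule ccontr)
    assume not: "\<not> ?thesis"
    have "r \<le> scale (J + i)" for i
    proof (induction i)
      case (Suc i)
      then have "\<not> scale (Suc (J + i)) \<le> r" using not le_add1 by blast
      then show ?case by simp
    qed (use assms in simp)
    then have "r \<le> scale (J + l)" .
    then show False using l scale_decseq[of l "J + l"] by simp
  qed
  then show ?thesis using that by blast
qed

lemma share_UN_le: "finite I \<Longrightarrow> share i (\<Union>n\<in>I. W n) \<le> (\<Sum>n\<in>I. share i (W n))"
  unfolding share_def sum_divide_distrib[symmetric]
proof (rule divide_right_mono)
  assume I: "finite I"
  have "card (centers i \<inter> (\<Union>n\<in>I. W n)) \<le> (\<Sum>n\<in>I. card (centers i \<inter> W n))"
    using card_UN_le[OF I, of "\<lambda>n. centers i \<inter> W n"] by simp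
  then show "real (card (centers i \<inter> (\<Union>n\<in>I. W n))) \<le> (\<Sum>n\<in>I. real (card (centers i \<inter> W n)))"
    by (simp flip: of_nat_sum)
qed simp

text \<open>The mass distribution principle without a limit measure: by compactness a cover of \<open>E\<close> by open
  sets covers all centers of some stage, and these are counted.\<close>

lemma hausdorff_measure_E_neq_0:
  assumes t: "0 \<le> t" "t < real (CARD('n) - 1) + \<alpha>"
  shows "hausdorff_measure t E \<noteq> 0"
proof
  assume null: "hausdorff_measure t E = 0"
  obtain Q J where Q: "0 < Q" "\<And>j i r U. J \<le> j \<Longrightarrow> scale (Suc j) \<le> 4 * r \<Longrightarrow> 4 * r \<le> scale j \<Longrightarrow> Suc j \<le> i \<Longrightarrow>
      (\<And>x y. x \<in> U \<Longrightarrow> y \<in> U \<Longrightarrow> dist x y \<le> r) \<Longrightarrow> share i U \<le> Q * r powr t"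
    using share_le_powr[OF t(2)] by blast
  \<comment> \<open>Cover sum and enlargement contribute at most \<open>e\<close> each, so all
    shares add up to at most \<open>2 * Q * e = 1 / 2\<close>, although the cover contains every
    center.\<close>
  define e where "e = 1 / (4 * Q)"
  have e: "0 < e" using Q by (simp add: e_def)
  \<comment> \<open>This mesh leaves room for \<open>h n < scale J / 4\<close>, so
    \<open>4 * h n\<close> falls between two consecutive scales from \<open>J\<close> on.\<close>
  have "hausdorff_premeasure t (scale J / 8) E < ennreal e"
    using null scale_pos[of J] e by (simp add: hausdorff_measure_eq_0_iff)
  then obtain U where U: "U \<in> delta_covers (scale J / 8) E" "(\<Sum>i. diam_pow t (U i)) < ennreal e"
    by (rule hausdorff_premeasure_cover)
  have bU: "bounded (U n)" "diameter (U n) < scale J / 4" for n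
  proof -
    have "bounded (U n) \<and> diameter (U n) \<le> scale J / 8" using U(1) by (simp add: delta_covers_def)
    then show "bounded (U n)" "diameter (U n) < scale J / 4" using scale_pos[of J] by linarith+
  qed
  have "\<exists>h. diameter (U n) < h \<and> h < scale J / 4 \<and>
      (U n \<noteq> {} \<longrightarrow> ennreal (h powr t) \<le> diam_pow t (U n) + ennreal (e * (1/2) ^ Suc n))" for n
  proof (cases "U n = {}")
    case True
    then show ?thesis using dense[OF bU(2)[of n]] by blast
  next
    case False
    have "0 < e * (1/2) ^ Suc n" using e by simp
    then show ?thesis using diam_pow_enlarge[OF bU(1) False t(1) _ bU(2)] by metis
  qed
  then obtain h where h: "\<And>n. diameter (U n) < h n" "\<And>n. h n < scale J / 4"
    "\<And>n. U n \<noteq> {} \<Longrightarrow> ennreal (h n powr t) \<le> diam_pow t (U n) + ennreal (e * (1/2) ^ Suc n)"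
    by metis
  have h0: "0 < h n" for n using h(1)[of n] diameter_ge_0[OF bU(1)[of n]] by linarith
  \<comment> \<open>Half of the excess of \<open>h n\<close> over the diameter, taken as radius,
    makes \<open>W n\<close> open while its points stay within distance \<open>h n\<close> of each
    other.\<close>
  define W where "W n = (\<Union>u\<in>U n. ball u ((h n - diameter (U n)) / 2))" for n
  have W_dist: "dist x y \<le> h n" if xy: "x \<in> W n" "y \<in> W n" for x y n
  proof -
    obtain u where u: "u \<in> U n" "x \<in> ball u ((h n - diameter (U n)) / 2)"
      using xy(1) unfolding W_def by (rule UN_E)
    obtain v where v: "v \<in> U n" "y \<in> ball v ((h n - diameter (U n)) / 2)"
      using xy(2) unfolding W_def by (rule UN_E)
    have "dist x y \<le> dist u x + dist u v + dist v y"
      using dist_triangle[of x y u] dist_triangle[of u y v] by (simp add: dist_commute)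
    also have "\<dots> \<le> (h n - diameter (U n)) / 2 + diameter (U n) + (h n - diameter (U n)) / 2"
      using u(2) v(2) unfolding mem_ball
      by (intro add_mono diameter_bounded_bound[OF bU(1) u(1) v(1)] less_imp_le)
    also have "\<dots> = h n" by simp
    finally show ?thesis .
  qed
  have EW: "E \<subseteq> (\<Union>n. W n)"
  proof
    fix x assume "x \<in> E"
    then obtain n where "x \<in> U n" using U(1) by (auto simp: delta_covers_def)
    moreover have "x \<in> ball x ((h n - diameter (U n)) / 2)" using h(1)[of n] by simp
    ultimately have "x \<in> W n" unfolding W_def by (rule UN_I)
    then show "x \<in> (\<Union>n. W n)" by (rule UN_I[OF UNIV_I])
  qed
  have openW: "open (W n)" for n unfolding W_def by (intro open_UN ballI open_ball)
  obtain I where I: "finite I" "E \<subseteq> (\<Union>n\<in>I. W n)"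
    by (rule compactE_image[OF compact_E, of UNIV W, OF openW EW])
  have "open (\<Union>n\<in>I. W n)" by (intro open_UN ballI openW)
  then obtain l where l: "stage l \<subseteq> (\<Union>n\<in>I. W n)"
    using I(2) by (rule stage_subset_open)
  have "\<exists>j\<ge>J. scale (Suc j) \<le> 4 * h n \<and> 4 * h n \<le> scale j" for n
    by (rule scale_exists[of "4 * h n" J]) (use h(2)[of n] h0[of n] in auto)
  then obtain jj where jj: "\<And>n. J \<le> jj n" "\<And>n. scale (Suc (jj n)) \<le> 4 * h n" "\<And>n. 4 * h n \<le> scale (jj n)"
    by metis
  \<comment> \<open>A single stage beyond \<open>l\<close> and beyond all scales occurring in the
    finite cover, so that all shares are compared at the same stage.\<close>
  define i where "i = Max (insert l ((\<lambda>n. Suc (jj n)) ` I))"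
  have i: "l \<le> i" "\<And>n. n \<in> I \<Longrightarrow> Suc (jj n) \<le> i"
    unfolding i_def using I(1) by (auto intro!: Max_ge)
  have "centers i \<subseteq> (\<Union>n\<in>I. W n)" using centers_subset_stage stage_antimono[OF i(1)] l by blast
  then have "centers i \<inter> (\<Union>n\<in>I. W n) = centers i" by blast
  then have "1 = share i (\<Union>n\<in>I. W n)" using card_centers_pos[of i] by (simp add: share_def)
  also have "\<dots> \<le> (\<Sum>n\<in>I. share i (W n))" by (rule share_UN_le[OF I(1)])
  finally have "ennreal 1 \<le> ennreal (\<Sum>n\<in>I. share i (W n))" by (rule ennreal_leI)
  also have "\<dots> = (\<Sum>n\<in>I. ennreal (share i (W n)))" by (rule sum_ennreal[symmetric]) (simp add: share_def)
  also have "\<dots> \<le> (\<Sum>n\<in>I. ennreal Q * (diam_pow t (U n) + ennreal (e * (1/2) ^ Suc n)))"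
  proof (rule sum_mono)
    fix n assume n: "n \<in> I"
    show "ennreal (share i (W n)) \<le> ennreal Q * (diam_pow t (U n) + ennreal (e * (1/2) ^ Suc n))"
    proof (cases "U n = {}")
      case True
      then show ?thesis by (simp add: W_def share_def)
    next
      case False
      have "share i (W n) \<le> Q * h n powr t"
        by (rule Q(2)[OF jj(1) jj(2) jj(3) i(2)[OF n] W_dist])
      then have "ennreal (share i (W n)) \<le> ennreal Q * ennreal (h n powr t)"
        using Q(1) by (simp add: ennreal_leI flip: ennreal_mult)
      also have "\<dots> \<le> ennreal Q * (diam_pow t (U n) + ennreal (e * (1/2) ^ Suc n))"
        by (rule mult_left_mono[OF h(3)[OF False]]) simp
      finally show ?thesis .
    qed
  qed
  also have "\<dots> = ennreal Q * (\<Sum>n\<in>I. diam_pow t (U n) + ennreal (e * (1/2) ^ Suc n))"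
    by (rule sum_distrib_left[symmetric])
  also have "\<dots> \<le> ennreal Q * (\<Sum>n. diam_pow t (U n) + ennreal (e * (1/2) ^ Suc n))"
    by (intro mult_left_mono sum_le_suminf summableI I(1)) auto
  also have "(\<Sum>n. diam_pow t (U n) + ennreal (e * (1/2) ^ Suc n))
      = (\<Sum>n. diam_pow t (U n)) + (\<Sum>n. ennreal (e * (1/2) ^ Suc n))"
    by (rule suminf_add[OF summableI summableI, symmetric])
  also have "(\<Sum>n. ennreal (e * (1/2) ^ Suc n)) = ennreal e"
    using e by (intro suminf_ennreal_half) simp
  also have "ennreal Q * ((\<Sum>n. diam_pow t (U n)) + ennreal e) \<le> ennreal Q * (ennreal e + ennreal e)"
    using U(2) by (intro mult_left_mono add_right_mono) auto
  also have "ennreal e + ennreal e = ennreal (e + e)" using e by (intro ennreal_plus[symmetric]) auto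
  also have "ennreal Q * ennreal (e + e) = ennreal (Q * (e + e))" using Q e by (simp add: ennreal_mult)
  also have "Q * (e + e) = 1 / 2" using Q by (simp add: e_def)
  finally have "ennreal 1 \<le> ennreal (1 / 2)" .
  then have "1 \<le> (1 / 2 :: real)" by (subst (asm) ennreal_le_iff) auto
  then show False by simp
qed

section \<open>Distances along one functional\<close>

lemma E_near_slab:
  assumes "x \<in> E"
  obtains z :: int where "\<bar>f j x $ k - gap j * of_int z\<bar> \<le> scale (Suc j) / 4"
proof -
  have "x \<in> stage (Suc j)" using assms by (auto simp: E_def)
  then obtain c n where c: "dist (child j c n) x \<le> scale (Suc j) / 4" by (auto simp: stage_def)
  have "f j (child j c n) $ k = gap j * of_int (\<lfloor>f j c $ k / gap j\<rfloor> + int (n k))"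
    by (simp add: f_child base_def spacing_def distrib_left)
  then have "\<bar>f j x $ k - gap j * of_int (\<lfloor>f j c $ k / gap j\<rfloor> + int (n k))\<bar> \<le> scale (Suc j) / 4"
    using f_dist_component[of j x k "child j c n"] c by (simp add: dist_commute)
  then show ?thesis by (rule that)
qed

text \<open>At a stage with \<open>f j = F\<close> the differences of coordinate \<open>k\<close>
  lie within \<open>scale (Suc j) / 2\<close> of multiples of \<open>gap j\<close>. At most
  \<open>3 / gap j\<close> intervals cover their absolute values, with a sum of order
  \<open>scale (Suc j) powr (t - expo j)\<close>, which is small when such a stage is late
  enough.\<close>

lemma hausdorff_measure_strip_distances_eq_0:
  assumes inf: "\<And>i. \<exists>j\<ge>i. f j = F" and c: "0 \<le> c" and t: "\<alpha> < t"
  shows "hausdorff_measure t {c * \<bar>F (x - y) $ k\<bar> | x y. x \<in> E \<and> y \<in> E} = 0" (is "hausdorff_measure t ?A = 0")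
  unfolding hausdorff_measure_eq_0_iff
proof (intro allI impI)
  fix d :: real assume d: "0 < d"
  \<comment> \<open>One half of the excess of \<open>t\<close> over \<alpha> dominates
    \<open>expo j - \<alpha>\<close>; the other half remains as a positive power of the
    scale.\<close>
  define g where "g = (t - \<alpha>) / 2"
  have g: "0 < g" using t by (simp add: g_def)
  define M where "M = 3 * (c + 1) powr t"
  show "hausdorff_premeasure t d ?A = 0"
  proof (rule ennreal_eq_0_if_le_mult_eps[of M])
    fix e :: real assume e: "0 < e"
    have "((\<lambda>j. scale (Suc j) powr g) \<longlongrightarrow> 0 powr g) sequentially"
      by (rule tendsto_powr') (use g LIMSEQ_Suc[OF scale_tendsto_0] in \<open>auto simp: less_imp_le[OF scale_pos]\<close>)
    then have ev1: "eventually (\<lambda>j. scale (Suc j) powr g < e) sequentially"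
      by (rule order_tendstoD) (use g e in auto)
    have "((\<lambda>j. (c + 1) * scale (Suc j)) \<longlongrightarrow> (c + 1) * 0) sequentially"
      by (intro tendsto_intros LIMSEQ_Suc[OF scale_tendsto_0])
    then have ev2: "eventually (\<lambda>j. (c + 1) * scale (Suc j) < d) sequentially"
      by (rule order_tendstoD) (use d in auto)
    have ev3: "eventually (\<lambda>j. 1 / real (Suc j) < g) sequentially"
      by (rule order_tendstoD(2)[OF LIMSEQ_Suc[OF lim_const_over_n[of 1]] g])
    obtain i where i: "\<And>j. j \<ge> i \<Longrightarrow> scale (Suc j) powr g < e \<and> (c + 1) * scale (Suc j) < d \<and> 1 / real (Suc j) < g"
      using eventually_conj[OF ev1 eventually_conj[OF ev2 ev3]] by (auto simp: eventually_sequentially)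
    obtain j where j: "j \<ge> i" "f j = F" using inf by blast
    note ij = i[OF j(1)]
    let ?scale = "scale (Suc j)"
    have scale: "0 < ?scale" "?scale \<le> 1" "?scale \<le> gap j" by (rule scale_pos scale_le_1 scale_Suc_le_gap)+
    have expo_le: "expo j \<le> t - g"
    proof -
      have "\<alpha> \<le> t - g" "g \<le> t - g" using t alpha by (auto simp: g_def field_simps)
      then show ?thesis using ij by (auto simp: expo_def)
    qed
    \<comment> \<open>\<open>c + 1\<close> instead of \<open>c\<close> keeps \<open>h\<close>
      positive when \<open>c = 0\<close>.\<close>
    define h where "h = (c + 1) * ?scale"
    have h: "0 < h" "h \<le> d" using scale c ij by (auto simp: h_def)
    define X where "X z = (\<lambda>w. c * w) ` cball (gap j * real z) (?scale / 2)" for z :: nat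
    \<comment> \<open>A difference has absolute value at most 1 and lies within
      \<open>?scale / 2\<close> of a multiple of the gap, so multiples up to 2 suffice.\<close>
    define G where "G = X ` {..nat \<lfloor>2 / gap j\<rfloor>}"
    have "bounded W \<and> diameter W \<le> h" if W: "W \<in> G" for W
    proof (rule diameter_le_dist)
      fix x y assume xy: "x \<in> W" "y \<in> W"
      obtain z where "W = X z" using W unfolding G_def by blast
      with xy have "x \<in> X z" "y \<in> X z" by auto
      then obtain w w' where w: "x = c * w" "w \<in> cball (gap j * real z) (?scale / 2)"
        "y = c * w'" "w' \<in> cball (gap j * real z) (?scale / 2)"
        unfolding X_def by (elim imageE)
      have "dist w w' \<le> ?scale" using w(2,4) dist_triangle3[of w w' "gap j * real z"] unfolding mem_cball by linarith
      then have "c * dist w w' \<le> c * ?scale" using c by (intro mult_left_mono) auto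
      moreover have "dist x y = c * dist w w'"
        using c by (simp add: w dist_real_def abs_mult flip: right_diff_distrib)
      ultimately show "dist x y \<le> h" using scale by (simp add: h_def distrib_right)
    qed (use h in simp)
    moreover have "?A \<subseteq> \<Union>G"
    proof clarify
      fix x y assume xy: "x \<in> E" "y \<in> E"
      obtain z z' where z: "\<bar>f j x $ k - gap j * of_int z\<bar> \<le> ?scale / 4" "\<bar>f j y $ k - gap j * of_int z'\<bar> \<le> ?scale / 4"
        using E_near_slab[OF xy(1)] E_near_slab[OF xy(2)] by metis
      define u where "u = F (x - y) $ k"
      have u: "u = f j x $ k - f j y $ k"
        unfolding u_def j(2)[symmetric]
        using linear_diff[OF orthogonal_transformation_linear[OF orth], of j x y] by simp
      then have u1: "\<bar>u - gap j * of_int (z - z')\<bar> \<le> ?scale / 2"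
      proof -
        have "gap j * of_int (z - z') = gap j * of_int z - gap j * of_int z'" by (simp add: right_diff_distrib)
        then show ?thesis using z unfolding u by argo
      qed
      have "\<bar>u\<bar> \<le> 1"
      proof -
        have "x \<in> stage 0" "y \<in> stage 0" using xy by (auto simp: E_def)
        then have "dist x y \<le> 1"
          using dist_triangle3[of x y 0] by (auto simp: stage_def)
        then show ?thesis using f_dist_component[of j x k y] u by simp
      qed
      define n where "n = nat \<bar>z - z'\<bar>"
      have n: "gap j * real n = \<bar>gap j * of_int (z - z')\<bar>"
        using gap_pos[of j] by (simp add: n_def abs_mult)
      then have un: "\<bar>\<bar>u\<bar> - gap j * real n\<bar> \<le> ?scale / 2" using u1 by linarith
      then have "gap j * real n \<le> 2" using \<open>\<bar>u\<bar> \<le> 1\<close> scale by linarith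
      then have "real n \<le> 2 / gap j" using gap_pos[of j] by (simp add: field_simps)
      then have "n \<le> nat \<lfloor>2 / gap j\<rfloor>" by (simp add: le_nat_floor)
      moreover have "c * \<bar>u\<bar> \<in> X n" using un by (auto simp: X_def dist_real_def abs_minus_commute)
      ultimately show "c * \<bar>F (x - y) $ k\<bar> \<in> \<Union>G" unfolding G_def u_def by blast
    qed
    moreover have "finite G" by (simp add: G_def)
    moreover have "0 \<le> t" using t alpha by simp
    ultimately have "hausdorff_premeasure t d ?A \<le> ennreal (real (card G) * h powr t)"
      using h by (intro hausdorff_premeasure_le_card) auto
    also have "real (card G) * h powr t \<le> M * e"
    proof -
      have "card G \<le> nat \<lfloor>2 / gap j\<rfloor> + 1"
        unfolding G_def using card_image_le[of "{..nat \<lfloor>2 / gap j\<rfloor>}" X] by simp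
      moreover have "real (nat \<lfloor>2 / gap j\<rfloor>) \<le> 2 / gap j" using gap_pos[of j] by simp
      moreover have "1 \<le> 1 / gap j" using gap_pos[of j] gap_le_1[of j] by simp
      moreover have "2 / gap j + 1 / gap j = 3 / gap j" by simp
      ultimately have "real (card G) \<le> 3 / gap j" by linarith
      then have "real (card G) * h powr t \<le> 3 / gap j * h powr t" by (intro mult_right_mono) auto
      also have "\<dots> = M * (?scale powr t / ?scale powr expo j)"
        using gap_eq[OF gap_pos, of j] scale c by (simp add: M_def h_def powr_mult)
      also have "?scale powr t / ?scale powr expo j = ?scale powr (t - expo j)" by (simp add: powr_diff)
      also have "M * \<dots> \<le> M * ?scale powr g"
        using scale expo_le by (intro mult_left_mono powr_mono') (auto simp: M_def)
      also have "\<dots> \<le> M * e" using ij by (intro mult_left_mono) (auto simp: M_def)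
      finally show ?thesis .
    qed
    finally show "hausdorff_premeasure t d ?A \<le> ennreal (M * e)" by (simp add: ennreal_leI)
  qed (simp add: M_def)
qed

end

section \<open>Assembly for a polyhedral norm\<close>

theorem theorem1p5:
  fixes p :: "real ^ 'n \<Rightarrow> real" and s :: real
  assumes "polyhedral_norm p"
    and "s \<in> {real CARD('n) - 1 .. real CARD('n)}"
  shows "\<exists>E :: (real ^ 'n) set.
           compact E \<and> hausdorff_dim E = ereal s \<and>
           hausdorff_dim (distance_set p E) = ereal (s - (real CARD('n) - 1))"
proof -
  obtain V where V: "finite V" "0 \<notin> V" "\<And>x. \<exists>v\<in>V. p x = \<bar>v \<bullet> x\<bar>"
    using polyhedral_norm_functionals[OF assms(1)] by blast
  obtain vs where vs: "set vs = V" using finite_list[OF V(1)] by blast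
  have len: "0 < length vs" using V(3) vs by fastforce
  obtain k :: 'n where True by simp
  have "\<exists>f :: real ^ 'n \<Rightarrow> real ^ 'n. orthogonal_transformation f \<and> (\<forall>x. v \<bullet> x = norm v * f x $ k)" for v
    by (rule orthogonal_coordinate[of v k]) blast
  then have "\<exists>F. \<forall>v. orthogonal_transformation (F v :: real ^ 'n \<Rightarrow> real ^ 'n) \<and>
      (\<forall>x. v \<bullet> x = norm v * F v x $ k)"
    by (intro choice allI)
  then obtain F :: "real ^ 'n \<Rightarrow> real ^ 'n \<Rightarrow> real ^ 'n"
    where F: "\<And>v. orthogonal_transformation (F v)" "\<And>v x. v \<bullet> x = norm v * F v x $ k"
    by blast
  define \<alpha> where "\<alpha> = s - (real CARD('n) - 1)"
  interpret slab_tree k "\<lambda>j. F (vs ! (j mod length vs))" \<alpha> "1 / (16 * real CARD('n))"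
    by unfold_locales (use F(1) assms(2) in \<open>auto simp: \<alpha>_def\<close>)
  have card: "real (CARD('n) - 1) = real CARD('n) - 1" by (simp add: of_nat_diff)
  have null: "hausdorff_measure t (distance_set p E) = 0" if t: "\<alpha> < t" for t
  proof -
    let ?A = "\<lambda>v. {norm v * \<bar>F v (x - y) $ k\<bar> | x y. x \<in> E \<and> y \<in> E}"
    have "hausdorff_measure t (?A v) = 0" if v: "v \<in> V" for v
    proof (rule hausdorff_measure_strip_distances_eq_0[OF _ norm_ge_zero t])
      fix i
      obtain l where l: "l < length vs" "vs ! l = v" using v vs by (metis in_set_conv_nth)
      \<comment> \<open>Adding \<open>i\<close> full periods to the position \<open>l\<close> of
        \<open>v\<close> reaches a stage not before \<open>i\<close> that uses \<open>v\<close>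
        again.\<close>
      then have "F (vs ! ((l + i * length vs) mod length vs)) = F v" by simp
      moreover have "i * 1 \<le> i * length vs" using len by (intro mult_le_mono2) (simp add: Suc_le_eq)
      then have "i \<le> l + i * length vs" by linarith
      ultimately show "\<exists>j\<ge>i. F (vs ! (j mod length vs)) = F v" by blast
    qed
    then have 0: "hausdorff_measure t (\<Union>v\<in>V. ?A v) = 0" by (rule hausdorff_measure_eq_0_UN[OF V(1)])
    have "distance_set p E \<subseteq> (\<Union>v\<in>V. ?A v)"
    proof
      fix r assume "r \<in> distance_set p E"
      then obtain x y where xy: "r = p (x - y)" "x \<in> E" "y \<in> E" by (auto simp: distance_set_def)
      obtain v where "v \<in> V" "p (x - y) = \<bar>v \<bullet> (x - y)\<bar>" using V(3) by blast
      then show "r \<in> (\<Union>v\<in>V. ?A v)" using xy by (auto simp: F(2) abs_mult)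
    qed
    then show ?thesis using 0 by (rule hausdorff_measure_eq_0_subset)
  qed
  \<comment> \<open>Used twice: nullity of the distance set above \<alpha> bounds the dimension of
    \<open>E\<close> from above, and contrapositively the nonzero measure of \<open>E\<close> below
    \<open>s\<close> bounds the dimension of the distance set from below.\<close>
  have transfer: "hausdorff_measure (t + (real CARD('n) - 1)) E = 0"
    if "0 \<le> t" "hausdorff_measure t (distance_set p E) = 0" for t
    by (rule hausdorff_measure_eq_0_if_distance_set[OF V compact_imp_bounded[OF compact_E] E_nonempty that])
  have "hausdorff_dim E = ereal s"
  proof (rule hausdorff_dim_eqI)
    have "0 \<le> real (CARD('n) - 1)" by simp
    then show "0 \<le> s" using assms(2) unfolding card atLeastAtMost_iff by linarith
    show "hausdorff_measure t E = 0" if "s < t" for t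
      using transfer[of "t - (real CARD('n) - 1)"] null[of "t - (real CARD('n) - 1)"] that assms(2)
      by (simp add: \<alpha>_def)
    show "hausdorff_measure t E \<noteq> 0" if "0 \<le> t" "t < s" for t
      using that by (intro hausdorff_measure_E_neq_0) (auto simp: \<alpha>_def card)
  qed
  moreover have "hausdorff_dim (distance_set p E) = ereal \<alpha>"
  proof (rule hausdorff_dim_eqI)
    show "0 \<le> \<alpha>" using assms(2) by (simp add: \<alpha>_def)
    show "hausdorff_measure t (distance_set p E) \<noteq> 0" if "0 \<le> t" "t < \<alpha>" for t
    proof
      assume "hausdorff_measure t (distance_set p E) = 0"
      then have "hausdorff_measure (t + real (CARD('n) - 1)) E = 0"
        unfolding card by (rule transfer[OF that(1)])
      then show False using hausdorff_measure_E_neq_0[of "t + real (CARD('n) - 1)"] that by simp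
    qed
  qed (rule null)
  ultimately show ?thesis using compact_E unfolding \<alpha>_def by blast
qed

end
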